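(* Let $(X_n)_{n\in\mathbb{N}}$ be a sequence of $\mathbb{Z}$-valued random variables with laws $\mu_n$, mod-$\phi$ convergent with parameters $\lambda_n\to+\infty$, and let $(\nu_n)_{n\in\mathbb{N}}$ be a general approximation scheme of $(X_n)_{n\in\mathbb{N}}$, with $\widehat{\mu_n}=e^{\lambda_n\phi}\psi_n$, $\widehat{\nu_n}=e^{\lambda_n\phi}\chi_n$, $\psi_n\to\psi$, $\chi_n\to\chi$. Let $r\geq 0$ be an integer and assume that there are constants $\beta_n,\beta$ with $\beta_n\to\beta$ such that $$\psi_n(\xi)-\chi_n(\xi)=\beta_n\,(i\xi)^{r+1}\,(1+o_\xi(1))\ \text{ for all } n\in\mathbb{N},\qquad \psi(\xi)-\chi(\xi)=\beta\,(i\xi)^{r+1}\,(1+o_\xi(1)),$$ where the $o_\xi(1)$ converge to $0$ as $\xi\to 0$, uniformly in $n$. Then $$d_{\mathrm K}(\mu_n,\nu_n)=\frac{|\beta|\,|G_{r}(z_{r+1})|}{\sqrt{2\pi}\,(\sigma^2\lambda_n)^{\frac{r+1}{2}}}+o\!\left(\frac{1}{(\lambda_n)^{\frac{r+1}{2}}}\right)\qquad (n\to\infty).$$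
   Context: Fourier transforms: for a (finite signed) measure $\mu$ on $\mathbb{Z}$, $\widehat\mu(\xi)=\sum_{k\in\mathbb{Z}}\mu(\{k\})e^{ik\xi}$, a function on $\mathbb{T}=\mathbb{R}/2\pi\mathbb{Z}$. Reference law: $\phi$ is the ($2\pi$-periodic, continuous, $\phi(0)=0$) exponent of an infinitely divisible probability law on $\mathbb{Z}$ with Fourier transform $e^{\phi(\xi)}$; this law has a second moment and is not supported on any proper sublattice of $\mathbb{Z}$. Then $\phi$ is twice continuously differentiable and $\phi(\xi)=im\xi-\frac{\sigma^2\xi^2}{2}+o(\xi^2)$ near $0$, with $\sigma^2>0$. For $\lambda>0$, $e^{\lambda\phi}$ is the Fourier transform of an infinitely divisible law on $\mathbb{Z}$. General approximation scheme: $\mu_n$ is the law of $X_n$, $\nu_n$ is a signed measure on $\mathbb{Z}$, and $\widehat{\mu_n}(\xi)=e^{\lambda_n\phi(\xi)}\psi_n(\xi)$, $\widehat{\nu_n}(\xi)=e^{\lambda_n\phi(\xi)}\chi_n(\xi)$ with $\lambda_n\to+\infty$, $\psi_n\to\psi$ and $\chi_n\to\chi$ uniformly on $\mathbb{T}$. The residues $\psi_n,\psi,\chi_n,\chi$ are functions on $\mathbb{T}$ with absolutely convergent Fourier series, and $\chi_n(0)=\chi(0)=1$. Mod-$\phi$ convergence of $(X_n)$ with parameters $\lambda_n$ and limit $\psi$ means precisely this property of $\widehat{\mu_n}$. Kolmogorov distance: $d_{\mathrm K}(\mu,\nu)=\sup_{k\in\mathbb{Z}}|\mu(\{j\in\mathbb{Z}: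 j\le k\})-\nu(\{j\in\mathbb{Z}: j\leq k\})|$. Hermite functions: $G_r(\alpha)=\frac{d^r}{d\alpha^r}\big(e^{-\alpha^2/2}\big)=(-1)^rH_r(\alpha)e^{-\alpha^2/2}$, where $H_r$ is the $r$-th Hermite polynomial; $z_{r}$ denotes the smallest absolute value of a zero of $H_{r}$. *)

theory Defs
  imports "HOL-Probability.Probability" "HOL-Library.Landau_Symbols"
begin

text \<open>
  A finite signed measure on \<open>\<int>\<close> (with the discrete \<open>\<sigma>\<close>-algebra) is a real-valued countably
  additive set function.  A probability law \<open>M\<close> on \<open>\<int>\<close> is viewed as such a set function
  through \<^term>\<open>measure M\<close>.
\<close>

definition finite_signed_measure :: "(int set \<Rightarrow> real) \<Rightarrow> bool" where
  "finite_signed_measure \<nu> \<longleftrightarrow>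
     (\<forall>A :: nat \<Rightarrow> int set. disjoint_family A \<longrightarrow> (\<lambda>i. \<nu> (A i)) sums \<nu> (\<Union>i. A i))"

definition fourier_Z :: "(int set \<Rightarrow> real) \<Rightarrow> real \<Rightarrow> complex" where
  "fourier_Z \<mu> \<xi> = (\<Sum>\<^sub>\<infinity>k\<in>UNIV. of_real (\<mu> {k}) * exp (\<i> * of_int k * of_real \<xi>))"

definition kolmogorov_dist :: "(int set \<Rightarrow> real) \<Rightarrow> (int set \<Rightarrow> real) \<Rightarrow> real" where
  "kolmogorov_dist \<mu> \<nu> = (SUP k. \<bar>\<mu> {j. j \<le> k} - \<nu> {j. j \<le> k}\<bar>)"

text \<open>
  Functions on \<open>\<real>/2\<pi>\<int>\<close> are represented by \<open>2\<pi>\<close>-periodic functions on \<^typ>\<open>real\<close>; in the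
  following definition periodicity is a consequence of the expansion.
\<close>

definition abs_conv_fourier_series :: "(real \<Rightarrow> complex) \<Rightarrow> bool" where
  "abs_conv_fourier_series f \<longleftrightarrow>
     (\<exists>c :: int \<Rightarrow> complex. (\<lambda>k. norm (c k)) summable_on UNIV \<and>
        (\<forall>\<xi>. f \<xi> = (\<Sum>\<^sub>\<infinity>k\<in>UNIV. c k * exp (\<i> * of_int k * of_real \<xi>))))"

text \<open>Infinite divisibility within \<open>\<int>\<close>: the convolution roots are themselves laws on \<open>\<int>\<close>.\<close>

definition infinitely_divisible_Z :: "int pmf \<Rightarrow> bool" where
  "infinitely_divisible_Z p \<longleftrightarrow>
     (\<forall>n::nat. n > 0 \<longrightarrow> (\<exists>q :: int pmf. p = map_pmf sum_list (replicate_pmf n q)))"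

text \<open>
  The sublattices (subgroups) of \<open>\<int>\<close> are the sets \<open>d\<int>\<close> with \<open>d \<ge> 0\<close>.  The case \<open>d = 0\<close> is
  included, so the Dirac mass at \<open>0\<close> is excluded.
\<close>

definition no_proper_sublattice :: "int pmf \<Rightarrow> bool" where
  "no_proper_sublattice p \<longleftrightarrow>
     (\<forall>d::nat. set_pmf p \<subseteq> range (\<lambda>j::int. int d * j) \<longrightarrow> d = 1)"

definition reference_exponent :: "int pmf \<Rightarrow> (real \<Rightarrow> complex) \<Rightarrow> bool" where
  "reference_exponent p \<phi> \<longleftrightarrow>
     infinitely_divisible_Z p \<and>
     integrable (measure_pmf p) (\<lambda>k. (real_of_int k)\<^sup>2) \<and>
     no_proper_sublattice p \<and>
     continuous_on UNIV \<phi> \<and>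
     (\<forall>\<xi>. \<phi> (\<xi> + 2 * pi) = \<phi> \<xi>) \<and>
     \<phi> 0 = 0 \<and>
     (\<forall>\<xi>. fourier_Z (measure (measure_pmf p)) \<xi> = exp (\<phi> \<xi>))"

text \<open>
  The residues \<open>\<psi>\<^sub>n\<close> and their limit \<open>\<psi>\<close> are arguments, since the hypotheses on a
  sequence refer to them.
\<close>

definition mod_phi_form ::
    "(real \<Rightarrow> complex) \<Rightarrow> (nat \<Rightarrow> int set \<Rightarrow> real) \<Rightarrow> (nat \<Rightarrow> real) \<Rightarrow>
     (nat \<Rightarrow> real \<Rightarrow> complex) \<Rightarrow> (real \<Rightarrow> complex) \<Rightarrow> bool" where
  "mod_phi_form \<phi> \<mu> lam \<psi> \<psi>lim \<longleftrightarrow>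
     filterlim lam at_top sequentially \<and>
     (\<forall>n. abs_conv_fourier_series (\<psi> n)) \<and> abs_conv_fourier_series \<psi>lim \<and>
     (\<forall>n \<xi>. fourier_Z (\<mu> n) \<xi> = exp (of_real (lam n) * \<phi> \<xi>) * \<psi> n \<xi>) \<and>
     uniform_limit UNIV \<psi> \<psi>lim sequentially"

definition law_Z :: "'a measure \<Rightarrow> ('a \<Rightarrow> int) \<Rightarrow> int set \<Rightarrow> real" where
  "law_Z M X = measure (distr M (count_space UNIV) X)"

definition mod_phi_convergent ::
    "(real \<Rightarrow> complex) \<Rightarrow> (nat \<Rightarrow> 'a measure) \<Rightarrow> (nat \<Rightarrow> 'a \<Rightarrow> int) \<Rightarrow> (nat \<Rightarrow> real) \<Rightarrow>
     (nat \<Rightarrow> real \<Rightarrow> complex) \<Rightarrow> (real \<Rightarrow> complex) \<Rightarrow> bool" where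
  "mod_phi_convergent \<phi> M X lam \<psi> \<psi>lim \<longleftrightarrow>
     mod_phi_form \<phi> (\<lambda>n. law_Z (M n) (X n)) lam \<psi> \<psi>lim"

definition approximation_scheme ::
    "(real \<Rightarrow> complex) \<Rightarrow> (nat \<Rightarrow> int set \<Rightarrow> real) \<Rightarrow> (nat \<Rightarrow> real) \<Rightarrow>
     (nat \<Rightarrow> real \<Rightarrow> complex) \<Rightarrow> (real \<Rightarrow> complex) \<Rightarrow> bool" where
  "approximation_scheme \<phi> \<nu> lam chi chilim \<longleftrightarrow>
     (\<forall>n. finite_signed_measure (\<nu> n)) \<and>
     mod_phi_form \<phi> \<nu> lam chi chilim \<and>
     (\<forall>n. chi n 0 = 1) \<and> chilim 0 = 1"

definition hermite_fun :: "nat \<Rightarrow> real \<Rightarrow> real" where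
  "hermite_fun r = (deriv ^^ r) (\<lambda>\<alpha>. exp (- \<alpha>\<^sup>2 / 2))"

text \<open>The probabilists' normalisation: \<open>H\<^sub>2 = X\<^sup>2 - 1\<close>.\<close>

primrec hermite_poly :: "nat \<Rightarrow> real poly" where
  "hermite_poly 0 = 1"
| "hermite_poly (Suc r) = [:0, 1:] * hermite_poly r - pderiv (hermite_poly r)"

lemma hermite_fun_eq:
  "hermite_fun r \<alpha> = (-1) ^ r * poly (hermite_poly r) \<alpha> * exp (- \<alpha>\<^sup>2 / 2)"
proof (induction r arbitrary: \<alpha>)
  case 0
  then show ?case by (simp add: hermite_fun_def)
next
  case (Suc r)
  have "hermite_fun (Suc r) \<alpha> = deriv (hermite_fun r) \<alpha>"
    by (simp add: hermite_fun_def)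
  also have "hermite_fun r = (\<lambda>\<alpha>. (-1) ^ r * poly (hermite_poly r) \<alpha> * exp (- \<alpha>\<^sup>2 / 2))"
    using Suc by blast
  also have "deriv \<dots> \<alpha> = (-1) ^ Suc r * poly (hermite_poly (Suc r)) \<alpha> * exp (- \<alpha>\<^sup>2 / 2)"
    by (rule DERIV_imp_deriv)
       (auto intro!: derivative_eq_intros simp: algebra_simps)
  finally show ?case .
qed

text \<open>
  The smallest absolute value of a zero of \<open>H\<^sub>r\<close>.  The set of zeros is finite; it is nonempty
  for \<open>r \<ge> 1\<close>, and \<open>hermite_z 0\<close> is meaningless.
\<close>

definition hermite_z :: "nat \<Rightarrow> real" where
  "hermite_z r = Min {\<bar>x\<bar> | x. poly (hermite_poly r) x = 0}"

end

theory Submission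
  imports Defs
begin

text \<open>
  The difference \<open>\<mu>\<^sub>n - \<nu>\<^sub>n\<close> has total mass \<open>0\<close>, so its distribution function at \<open>k\<close> is, up to an
  additive constant, the Fourier coefficient of
  \<open>e\<^bsup>\<lambda>\<phi>(\<xi>)\<^esup> (\<psi>\<^sub>n - \<chi>\<^sub>n)(\<xi>) / (1 - e\<^bsup>i\<xi>\<^esup>)\<close> with \<open>\<lambda> = \<lambda>\<^sub>n\<close>.  Infinite divisibility and the absence of a
  proper sublattice give \<open>Re \<phi>(\<xi>) \<le> - c \<xi>\<^sup>2\<close> on \<open>[-\<pi>, \<pi>]\<close>; after the scaling \<open>\<xi> = u / T\<close> with
  \<open>T\<^sup>2 = \<sigma>\<^sup>2 \<lambda>\<close>, dominated convergence shows, uniformly in \<open>k\<close>, that the distribution function is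
  \<open>- \<beta> G\<^sub>r((m \<lambda> - k) / T) / (\<surd>(2\<pi>) T\<^bsup>r+1\<^esup>)\<close> up to \<open>o(T\<^bsup>-(r+1)\<^esup>)\<close>.  The points \<open>(m \<lambda> - k) / T\<close> form a
  grid of vanishing mesh, so the supremum over \<open>k\<close> converges to that of \<open>\<bar>G\<^sub>r\<bar>\<close> over the line, which
  is attained at the zero of \<open>G\<^sub>r\<^sub>+\<^sub>1\<close> closest to the origin because the relative extrema of \<open>G\<^sub>r\<close>
  decrease with the distance to the origin (Sonin's argument).
\<close>

subsection \<open>Hermite functions\<close>

lemma hermite_fun_0: "hermite_fun 0 x = exp (- x\<^sup>2 / 2)"
  by (simp add: hermite_fun_def)

lemma has_real_derivative_hermite_fun:
  "(hermite_fun r has_real_derivative hermite_fun (Suc r) x) (at x within A)"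
proof -
  have "hermite_fun r = (\<lambda>x. (-1) ^ r * poly (hermite_poly r) x * exp (- x\<^sup>2 / 2))"
    by (simp add: fun_eq_iff hermite_fun_eq)
  then show ?thesis
    unfolding hermite_fun_eq[of "Suc r" x]
    by (auto intro!: derivative_eq_intros simp: algebra_simps)
qed

lemma continuous_on_hermite_fun [continuous_intros]: "continuous_on A (hermite_fun r)"
  using has_real_derivative_hermite_fun by (rule DERIV_continuous_on)

text \<open>Differentiating the recursion, the induction hypothesis replaces derivatives of
  \<open>hermite_poly (Suc r)\<close> by multiples of \<open>hermite_poly r\<close>, and the
  recursion reassembles what is left. This is the Appell property.\<close>

lemma pderiv_hermite_poly: "pderiv (hermite_poly (Suc r)) = smult (real r + 1) (hermite_poly r)"
proof (induction r)
  case 0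
  show ?case by (simp add: pderiv_pCons)
next
  case (Suc r)
  have "pderiv (hermite_poly (Suc (Suc r))) =
      pderiv ([:0, 1:] * hermite_poly (Suc r)) - pderiv (pderiv (hermite_poly (Suc r)))"
    by (simp only: hermite_poly.simps(2)[of "Suc r"] pderiv_diff)
  also have "\<dots> = hermite_poly (Suc r) + smult (real r + 1)
      ([:0, 1:] * hermite_poly r - pderiv (hermite_poly r))"
    unfolding Suc.IH pderiv_mult pderiv_smult
    by (simp add: pderiv_pCons smult_diff_right)
  also have "\<dots> = smult (1 + (real r + 1)) (hermite_poly (Suc r))"
    by (simp only: hermite_poly.simps(2)[of r, symmetric] smult_add_left smult_1_left)
  also have "1 + (real r + 1) = real (Suc r) + 1" by simp
  finally show ?case .
qed

text \<open>Eliminating the derivative from the recursion by the Appell property leaves a three-term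
  recurrence; parity, separation of zeros, Sonin's monotonicity and the Gaussian integrals all rest
  on it.\<close>

lemma hermite_fun_Suc_Suc:
  "hermite_fun (Suc (Suc r)) x = - x * hermite_fun (Suc r) x - (real r + 1) * hermite_fun r x"
proof -
  have "poly (hermite_poly (Suc (Suc r))) x =
      x * poly (hermite_poly (Suc r)) x - (real r + 1) * poly (hermite_poly r) x"
    by (simp only: hermite_poly.simps(2)[of "Suc r"] pderiv_hermite_poly) simp
  then show ?thesis
    unfolding hermite_fun_eq
    by (simp only: power_Suc) (simp add: algebra_simps del: hermite_poly.simps)
qed

lemma hermite_fun_1: "hermite_fun (Suc 0) x = - x * hermite_fun 0 x"
  by (simp add: hermite_fun_eq)

lemma hermite_fun_minus: "hermite_fun r (- x) = (-1) ^ r * hermite_fun r x"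
proof (induction r rule: induct_nat_012)
  case (ge2 n)
  then show ?case by (simp add: hermite_fun_Suc_Suc algebra_simps)
qed (simp_all add: hermite_fun_0 hermite_fun_1)

section \<open>Decay, zeros and the global maximum of Hermite functions\<close>

lemma power_exp_sq_tendsto_0: "((\<lambda>x::real. x ^ k * exp (- (1/2) * x\<^sup>2)) \<longlongrightarrow> 0) at_top"
proof (rule tendsto_sandwich[OF _ _ tendsto_const tendsto_power_div_exp_0[of k]])
  show "\<forall>\<^sub>F x::real in at_top. 0 \<le> x ^ k * exp (- (1/2) * x\<^sup>2)"
    using eventually_ge_at_top[of 0] by eventually_elim simp
  show "\<forall>\<^sub>F x::real in at_top. x ^ k * exp (- (1/2) * x\<^sup>2) \<le> x ^ k / exp x"
    using eventually_ge_at_top[of 2]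
  proof eventually_elim
    case (elim x)
    \<comment> \<open>From \<open>x = 2\<close> on, the Gaussian lies below
      \<open>exp (- x)\<close>, against which powers are known to vanish.\<close>
    have "2 * x \<le> x\<^sup>2" using elim by (simp add: power2_eq_square)
    then have "exp (- (1/2) * x\<^sup>2) \<le> exp (- x)" by simp
    then have "x ^ k * exp (- (1/2) * x\<^sup>2) \<le> x ^ k * exp (- x)"
      by (rule mult_left_mono) (use elim in simp)
    also have "\<dots> = x ^ k / exp x" by (simp only: exp_minus divide_inverse)
    finally show ?case .
  qed
qed

lemma hermite_fun_tendsto_0_at_top: "(hermite_fun r \<longlongrightarrow> 0) at_top"
proof -
  have *: "((\<lambda>x::real. x ^ k * exp (- x\<^sup>2 / 2)) \<longlongrightarrow> 0) at_top" for k
    using power_exp_sq_tendsto_0[of k] by simp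
  have "((\<lambda>x. (-1) ^ r * (\<Sum>i\<le>degree (hermite_poly r).
      coeff (hermite_poly r) i * (x ^ i * exp (- x\<^sup>2 / 2)))) \<longlongrightarrow>
      (-1) ^ r * (\<Sum>i\<le>degree (hermite_poly r). coeff (hermite_poly r) i * 0)) at_top"
    by (rule tendsto_mult[OF tendsto_const tendsto_sum[OF tendsto_mult[OF tendsto_const *]]])
  moreover have "hermite_fun r = (\<lambda>x. (-1) ^ r * (\<Sum>i\<le>degree (hermite_poly r).
      coeff (hermite_poly r) i * (x ^ i * exp (- x\<^sup>2 / 2))))"
    by (simp only: fun_eq_iff hermite_fun_eq poly_altdef sum_distrib_right mult.assoc simp_thms)
  ultimately show ?thesis by (simp only: mult_zero_right sum.neutral_const)
qed

text \<open>By the recurrence a common zero of two consecutive functions would descend to a zero of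
  \<open>hermite_fun 0\<close>, which is positive everywhere.\<close>

lemma hermite_fun_not_both_0: "hermite_fun r x = 0 \<Longrightarrow> hermite_fun (Suc r) x \<noteq> 0"
  by (induction r) (auto simp: hermite_fun_0 hermite_fun_Suc_Suc)

lemma hermite_poly_nonzero: "hermite_poly r \<noteq> 0"
proof
  assume 0: "hermite_poly r = 0"
  then have "hermite_fun r 0 = 0" "hermite_fun (Suc r) 0 = 0" by (simp_all add: hermite_fun_eq)
  then show False using hermite_fun_not_both_0 by blast
qed

lemma hermite_fun_eq_0_iff: "hermite_fun r x = 0 \<longleftrightarrow> poly (hermite_poly r) x = 0"
  by (simp add: hermite_fun_eq)

lemma abs_hermite_fun_abs: "\<bar>hermite_fun r \<bar>x\<bar>\<bar> = \<bar>hermite_fun r x\<bar>"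
  by (cases "x \<ge> 0") (simp_all add: hermite_fun_minus abs_mult)

text \<open>A continuous function that vanishes at infinity without being identically zero attains
  the maximum of its modulus; parity moves the maximiser to the nonnegative half-line.\<close>

lemma hermite_fun_max_exists: "\<exists>t\<ge>0. \<forall>x. \<bar>hermite_fun r x\<bar> \<le> \<bar>hermite_fun r t\<bar>"
proof -
  have "finite {x. poly (hermite_poly r) x = 0}"
    using hermite_poly_nonzero poly_roots_finite by blast
  then obtain a where "hermite_fun r a \<noteq> 0"
    using ex_new_if_finite[OF infinite_UNIV_char_0] unfolding hermite_fun_eq_0_iff by blast
  then have "\<forall>\<^sub>F x in at_top. \<bar>hermite_fun r x\<bar> < \<bar>hermite_fun r a\<bar>"
    using tendstoD[OF hermite_fun_tendsto_0_at_top[of r], of "\<bar>hermite_fun r a\<bar>"] by simp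
  then obtain N where N: "\<And>x. x \<ge> N \<Longrightarrow> \<bar>hermite_fun r x\<bar> < \<bar>hermite_fun r a\<bar>"
    unfolding eventually_at_top_linorder by auto
  \<comment> \<open>The interval reaches up to \<open>\<bar>a\<bar>\<close> so that its maximum
    dominates the value at \<open>a\<close>, which in turn bounds everything beyond
    \<open>N\<close>.\<close>
  have "\<exists>t\<in>{0..max N \<bar>a\<bar>}. \<forall>x\<in>{0..max N \<bar>a\<bar>}. \<bar>hermite_fun r x\<bar> \<le> \<bar>hermite_fun r t\<bar>"
    by (rule continuous_attains_sup) (auto intro!: continuous_intros simp: le_max_iff_disj)
  then obtain t where t: "0 \<le> t"
    "\<And>x. 0 \<le> x \<Longrightarrow> x \<le> max N \<bar>a\<bar> \<Longrightarrow> \<bar>hermite_fun r x\<bar> \<le> \<bar>hermite_fun r t\<bar>" by auto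
  have "\<bar>hermite_fun r x\<bar> \<le> \<bar>hermite_fun r t\<bar>" for x
  proof (cases "\<bar>x\<bar> \<le> max N \<bar>a\<bar>")
    case True
    then show ?thesis using t(2)[of "\<bar>x\<bar>"] by (simp add: abs_hermite_fun_abs)
  next
    case False
    then have "\<bar>hermite_fun r x\<bar> < \<bar>hermite_fun r a\<bar>"
      using N[of "\<bar>x\<bar>"] by (simp add: abs_hermite_fun_abs)
    also have "\<dots> \<le> \<bar>hermite_fun r t\<bar>"
      using t(2)[of "\<bar>a\<bar>"] by (simp add: abs_hermite_fun_abs)
    finally show ?thesis by simp
  qed
  with t(1) show ?thesis by blast
qed

text \<open>Sonin's function: its derivative is \<open>-2x G\<^sub>r\<^sub>+\<^sub>1\<^sup>2 / (r+1)\<close>, and at a critical point of \<open>G\<^sub>r\<close>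
  it equals \<open>G\<^sub>r\<^sup>2\<close>.\<close>

lemma hermite_sonin_decreasing:
  assumes "0 \<le> x" "x \<le> y"
  shows "(hermite_fun r y)\<^sup>2 + (hermite_fun (Suc r) y)\<^sup>2 / (real r + 1) \<le>
         (hermite_fun r x)\<^sup>2 + (hermite_fun (Suc r) x)\<^sup>2 / (real r + 1)"
    (is "?V y \<le> ?V x")
proof (rule DERIV_nonpos_imp_nonincreasing[OF assms(2)])
  fix u assume u: "x \<le> u" "u \<le> y"
  have "(?V has_real_derivative
     2 * hermite_fun r u * hermite_fun (Suc r) u +
     2 * hermite_fun (Suc r) u * hermite_fun (Suc (Suc r)) u / (real r + 1)) (at u)"
    by (rule DERIV_cong[OF DERIV_add[OF DERIV_power[OF has_real_derivative_hermite_fun]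
          DERIV_cdivide[OF DERIV_power[OF has_real_derivative_hermite_fun]]]])
      simp
  moreover have "2 * hermite_fun r u * hermite_fun (Suc r) u +
     2 * hermite_fun (Suc r) u * hermite_fun (Suc (Suc r)) u / (real r + 1) =
     - (2 * u * (hermite_fun (Suc r) u)\<^sup>2 / (real r + 1))"
    unfolding hermite_fun_Suc_Suc by (simp add: divide_simps) (simp add: algebra_simps power2_eq_square)
  moreover have "0 \<le> 2 * u * (hermite_fun (Suc r) u)\<^sup>2 / (real r + 1)"
    using u assms by simp
  ultimately show "\<exists>D. (?V has_real_derivative D) (at u) \<and> D \<le> 0" by force
qed

text \<open>A global maximiser \<open>t\<close> is critical, hence a zero of the next Hermite
  polynomial and at least \<open>hermite_z (Suc r)\<close>. At both points Sonin's function reduces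
  to the square of \<open>hermite_fun r\<close>, and it does not increase from the smaller point to
  the larger.\<close>

lemma abs_hermite_fun_le_at_hermite_z:
  "\<bar>hermite_fun r x\<bar> \<le> \<bar>hermite_fun r (hermite_z (Suc r))\<bar>"
proof -
  let ?Z = "{\<bar>x\<bar> | x. poly (hermite_poly (Suc r)) x = 0}"
  obtain t where t: "0 \<le> t" "\<And>x. \<bar>hermite_fun r x\<bar> \<le> \<bar>hermite_fun r t\<bar>"
    using hermite_fun_max_exists by blast
  \<comment> \<open>The square stands in for the absolute value to make the function differentiable;
    its derivative also vanishes at zeros of \<open>hermite_fun r\<close>, so these are excluded
    next.\<close>
  have "((\<lambda>x. (hermite_fun r x)\<^sup>2) has_real_derivative 2 * hermite_fun r t * hermite_fun (Suc r) t) (at t)"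
    by (auto intro!: derivative_eq_intros has_real_derivative_hermite_fun)
  then have "2 * hermite_fun r t * hermite_fun (Suc r) t = 0"
    by (rule DERIV_local_max[where d = 1]) (simp_all add: t(2) abs_le_square_iff[symmetric])
  moreover have "hermite_fun r t \<noteq> 0"
  proof
    assume "hermite_fun r t = 0"
    then have "hermite_fun r x = 0" for x using t(2)[of x] by simp
    then have "hermite_fun r = (\<lambda>x. 0)" by auto
    with has_real_derivative_hermite_fun[of r 0] have "hermite_fun (Suc r) 0 = 0"
      by (metis DERIV_const DERIV_unique)
    with \<open>\<And>x. hermite_fun r x = 0\<close> hermite_fun_not_both_0 show False by blast
  qed
  ultimately have "poly (hermite_poly (Suc r)) t = 0" by (simp add: hermite_fun_eq_0_iff)
  \<comment> \<open>This membership also makes the set nonempty, so its \<open>Min\<close> is a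
    genuine element.\<close>
  then have tZ: "t \<in> ?Z" using t(1) by force
  have "?Z = abs ` {x. poly (hermite_poly (Suc r)) x = 0}" by auto
  then have fin: "finite ?Z" using hermite_poly_nonzero poly_roots_finite by (metis finite_imageI)
  have "hermite_z (Suc r) \<in> ?Z" using fin tZ unfolding hermite_z_def by (intro Min_in) auto
  then obtain x where x: "hermite_z (Suc r) = \<bar>x\<bar>" "hermite_fun (Suc r) x = 0"
    unfolding hermite_fun_eq_0_iff by blast
  have z: "0 \<le> hermite_z (Suc r)" "hermite_fun (Suc r) (hermite_z (Suc r)) = 0"
    using abs_hermite_fun_abs[of "Suc r" x] x by simp_all
  have zt: "hermite_z (Suc r) \<le> t" using fin tZ unfolding hermite_z_def by (intro Min_le)
  have "0 \<le> (hermite_fun (Suc r) t)\<^sup>2 / (real r + 1)" by simp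
  with hermite_sonin_decreasing[OF z(1) zt, of r]
  have "(hermite_fun r t)\<^sup>2 \<le> (hermite_fun r (hermite_z (Suc r)))\<^sup>2"
    unfolding z(2) by (simp only: zero_power2 div_0 add_0_right)
  then have "\<bar>hermite_fun r t\<bar> \<le> \<bar>hermite_fun r (hermite_z (Suc r))\<bar>"
    by (simp add: abs_le_square_iff)
  with t(2) show ?thesis by (rule order_trans)
qed

subsection \<open>Fourier transform of Gaussian moments\<close>

lemma integrable_gaussian_moment:
  assumes "c > 0"
  shows "integrable lborel (\<lambda>u::real. exp (- c * u\<^sup>2) * \<bar>u\<bar> ^ k)"
proof -
  \<comment> \<open>The standard deviation for which the normal density has exponent
    \<open>- c * u^2\<close>.\<close>
  define s where "s = sqrt (1 / (2 * c))"
  have s: "s > 0" "s\<^sup>2 = 1 / (2 * c)" using assms by (simp_all add: s_def)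
  have "integrable lborel (\<lambda>u. sqrt (2 * pi * s\<^sup>2) * (normal_density 0 s u * \<bar>u - 0\<bar> ^ k))"
    by (intro integrable_mult_right integrable_normal_moment_abs s)
  also have "(\<lambda>u. sqrt (2 * pi * s\<^sup>2) * (normal_density 0 s u * \<bar>u - 0\<bar> ^ k)) =
      (\<lambda>u. exp (- c * u\<^sup>2) * \<bar>u\<bar> ^ k)"
    using s by (auto simp: normal_density_def fun_eq_iff field_simps)
  finally show ?thesis .
qed

text \<open>The factor \<open>(\<i> * of_real u) ^ r\<close> is what \<open>r\<close> derivatives in
  \<open>x\<close> bring down from the wave, so the integral over \<open>u\<close> is the
  \<open>r\<close>-th derivative of a Gaussian in \<open>x\<close>, up to the factor
  \<open>sqrt (2 * pi)\<close>.\<close>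

definition gauss_wave :: "nat \<Rightarrow> real \<Rightarrow> real \<Rightarrow> complex" where
  "gauss_wave r x u = exp (of_real (- u\<^sup>2 / 2) + \<i> * of_real (u * x)) * (\<i> * of_real u) ^ r"

lemma norm_gauss_wave: "norm (gauss_wave r x u) = exp (- (1/2) * u\<^sup>2) * \<bar>u\<bar> ^ r"
  by (simp add: gauss_wave_def norm_mult norm_power)

lemma isCont_gauss_wave [continuous_intros]: "isCont (gauss_wave r x) u"
  unfolding gauss_wave_def by (intro continuous_intros) simp

lemma borel_measurable_gauss_wave [measurable]: "gauss_wave r x \<in> borel_measurable borel"
  by (intro borel_measurable_continuous_onI continuous_at_imp_continuous_on ballI isCont_gauss_wave)

lemma integrable_gauss_wave: "integrable lborel (gauss_wave r x)"
  by (rule Bochner_Integration.integrable_bound[OF integrable_gaussian_moment[of "1/2" r]])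
     (simp_all add: norm_gauss_wave)

lemma gauss_wave_tendsto_0:
  "(gauss_wave r x \<longlongrightarrow> 0) at_top" "(gauss_wave r x \<longlongrightarrow> 0) at_bot"
proof -
  have *: "((\<lambda>x::real. x ^ k * exp (- (1/2) * x\<^sup>2)) \<longlongrightarrow> 0) at_top" for k
    by (rule power_exp_sq_tendsto_0)
  have "((\<lambda>u. norm (gauss_wave r x u)) \<longlongrightarrow> 0) at_top"
  proof (rule Lim_transform_eventually[OF *[of r]])
    show "\<forall>\<^sub>F u in at_top. u ^ r * exp (- (1/2) * u\<^sup>2) = norm (gauss_wave r x u)"
      using eventually_ge_at_top[of 0] by eventually_elim (simp add: norm_gauss_wave)
  qed
  then show "(gauss_wave r x \<longlongrightarrow> 0) at_top" by (rule tendsto_norm_zero_cancel)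
  have "((\<lambda>u. norm (gauss_wave r x (- u))) \<longlongrightarrow> 0) at_top"
  proof (rule Lim_transform_eventually[OF *[of r]])
    show "\<forall>\<^sub>F u in at_top. u ^ r * exp (- (1/2) * u\<^sup>2) = norm (gauss_wave r x (- u))"
      using eventually_ge_at_top[of 0] by eventually_elim (simp add: norm_gauss_wave)
  qed
  then have "((\<lambda>u. gauss_wave r x (- u)) \<longlongrightarrow> 0) at_top" by (rule tendsto_norm_zero_cancel)
  then show "(gauss_wave r x \<longlongrightarrow> 0) at_bot" by (simp add: at_bot_mirror filterlim_filtermap)
qed

lemma integral_derivative_eq_0:
  fixes F f :: "real \<Rightarrow> complex"
  assumes "\<And>u. (F has_vector_derivative f u) (at u)" "\<And>u. isCont f u" "integrable lborel f"
    and "(F \<longlongrightarrow> 0) at_top" "(F \<longlongrightarrow> 0) at_bot"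
  shows "(\<integral>u. f u \<partial>lborel) = 0"
proof -
  have "(LBINT u=-\<infinity>..\<infinity>. f u) = 0 - 0"
  proof (rule interval_integral_FTC_integrable)
    show "set_integrable lborel (einterval (-\<infinity>) \<infinity>) f"
      using assms(3) by (simp add: set_integrable_def)
    show "((F \<circ> real_of_ereal) \<longlongrightarrow> 0) (at_right (-\<infinity>))"
      using assms(5) by (simp add: ereal_tendsto_simps)
    show "((F \<circ> real_of_ereal) \<longlongrightarrow> 0) (at_left \<infinity>)"
      using assms(4) by (simp add: ereal_tendsto_simps)
  qed (use assms in auto)
  then show ?thesis by (simp add: interval_lebesgue_integral_def set_lebesgue_integral_def)
qed

text \<open>Integrated over the line, this derivative gives zero, which is the recurrence of
  \<open>hermite_fun\<close> for the integrals; differentiation under the integral sign is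
  avoided.\<close>

lemma gauss_wave_has_derivative:
  "(gauss_wave (Suc r) x has_vector_derivative
     \<i> * (gauss_wave (Suc (Suc r)) x u + x * gauss_wave (Suc r) x u + (real r + 1) * gauss_wave r x u)) (at u)"
proof -
  \<comment> \<open>The entire extension is differentiated and then restricted to the real
    axis.\<close>
  have "((\<lambda>z::complex. exp (- z\<^sup>2 / 2 + \<i> * (z * x)) * (\<i> * z) ^ Suc r) has_field_derivative
      \<i> * (gauss_wave (Suc (Suc r)) x u + x * gauss_wave (Suc r) x u + (real r + 1) * gauss_wave r x u))
      (at (of_real u))"
    by (rule derivative_eq_intros refl | simp)+
      (simp add: gauss_wave_def algebra_simps power2_eq_square exp_add)
  from has_vector_derivative_real_field[OF this] show ?thesis
    by (simp add: gauss_wave_def[abs_def])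
qed

lemma gauss_wave_has_derivative_0:
  "(gauss_wave 0 x has_vector_derivative
     \<i> * (gauss_wave (Suc 0) x u + x * gauss_wave 0 x u)) (at u)"
proof -
  have "((\<lambda>z::complex. exp (- z\<^sup>2 / 2 + \<i> * (z * x))) has_field_derivative
      \<i> * (gauss_wave (Suc 0) x u + x * gauss_wave 0 x u)) (at (of_real u))"
    by (rule derivative_eq_intros refl | simp)+
      (simp add: gauss_wave_def algebra_simps power2_eq_square exp_add)
  from has_vector_derivative_real_field[OF this] show ?thesis
    by (simp add: gauss_wave_def[abs_def])
qed

lemma integral_gauss_wave_0: "(\<integral>u. gauss_wave 0 x u \<partial>lborel) = of_real (sqrt (2 * pi) * exp (- x\<^sup>2 / 2))"
proof -
  have "char std_normal_distribution x = of_real (exp (- x\<^sup>2 / 2))"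
    by (simp add: char_std_normal_distribution)
  then have "(\<integral>u. of_real (std_normal_density u) * iexp (x * u) \<partial>lborel) = of_real (exp (- x\<^sup>2 / 2))"
    by (simp add: char_def integral_density scaleR_conv_of_real)
  moreover have "(\<integral>u. gauss_wave 0 x u \<partial>lborel) =
      (\<integral>u. of_real (sqrt (2 * pi)) * (of_real (std_normal_density u) * iexp (x * u)) \<partial>lborel)"
    by (intro Bochner_Integration.integral_cong refl)
       (simp add: gauss_wave_def std_normal_density_def mult.commute flip: exp_of_real exp_add)
  ultimately show ?thesis by simp
qed

text \<open>Two-step induction: case 0 is the characteristic function of the standard normal law,
  the others integrate the derivative of a lower wave to zero and match the recurrence.\<close>

theorem integral_gauss_wave:
  "(\<integral>u. gauss_wave r x u \<partial>lborel) = of_real (sqrt (2 * pi) * hermite_fun r x)"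
proof (induction r rule: induct_nat_012)
  case 0
  show ?case by (simp add: integral_gauss_wave_0 hermite_fun_0)
next
  case 1
  have "(\<integral>u. \<i> * (gauss_wave (Suc 0) x u + x * gauss_wave 0 x u) \<partial>lborel) = 0"
    by (rule integral_derivative_eq_0[OF gauss_wave_has_derivative_0])
       (auto intro!: continuous_intros integrable_mult_right Bochner_Integration.integrable_add integrable_gauss_wave gauss_wave_tendsto_0)
  then have "(\<integral>u. gauss_wave (Suc 0) x u \<partial>lborel) = - (x * (\<integral>u. gauss_wave 0 x u \<partial>lborel))"
    by (simp add: integrable_gauss_wave eq_neg_iff_add_eq_0)
  then show ?case by (simp add: integral_gauss_wave_0 hermite_fun_1 hermite_fun_0)
next
  case (ge2 r)
  have "(\<integral>u. \<i> * (gauss_wave (Suc (Suc r)) x u + x * gauss_wave (Suc r) x u + (real r + 1) * gauss_wave r x u) \<partial>lborel) = 0"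
    by (rule integral_derivative_eq_0[OF gauss_wave_has_derivative])
       (auto intro!: continuous_intros integrable_mult_right Bochner_Integration.integrable_add integrable_gauss_wave gauss_wave_tendsto_0)
  then have "(\<integral>u. gauss_wave (Suc (Suc r)) x u \<partial>lborel) + x * (\<integral>u. gauss_wave (Suc r) x u \<partial>lborel) +
      (real r + 1) * (\<integral>u. gauss_wave r x u \<partial>lborel) = 0"
    by (simp add: integrable_gauss_wave)
  then have "(\<integral>u. gauss_wave (Suc (Suc r)) x u \<partial>lborel) = - (x * (\<integral>u. gauss_wave (Suc r) x u \<partial>lborel)) -
      (real r + 1) * (\<integral>u. gauss_wave r x u \<partial>lborel)"
    by (simp add: algebra_simps eq_neg_iff_add_eq_0)
  also have "\<dots> = of_real (sqrt (2 * pi) * hermite_fun (Suc (Suc r)) x)"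
    unfolding ge2 hermite_fun_Suc_Suc by (simp add: algebra_simps)
  finally show ?case .
qed

subsection \<open>Signed measures on the integers\<close>

lemma finite_signed_measure_empty: "finite_signed_measure \<nu> \<Longrightarrow> \<nu> {} = 0"
  unfolding finite_signed_measure_def
  by (drule spec[of _ "\<lambda>_. {}"]) (auto simp: disjoint_family_on_def sums_iff summable_const_iff)

lemma finite_signed_measure_measure:
  assumes "finite_measure N" "sets N = UNIV"
  shows "finite_signed_measure (measure N)"
  unfolding finite_signed_measure_def
  using finite_measure.finite_measure_UNION[OF assms(1)] assms(2) by auto

text \<open>Countable additivity along an enumeration of the integers gives a convergent series for
  every set; applied to the sets of nonnegative and of negative atoms it yields absolute
  summability, after which the order of summation is immaterial.\<close>

lemma finite_signed_measure_has_sum: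
  assumes "finite_signed_measure \<nu>"
  shows "(\<lambda>k. norm (\<nu> {k})) summable_on UNIV"
    and "((\<lambda>k. \<nu> {k}) has_sum \<nu> A) A"
proof -
  define e where "e = (from_nat_into (UNIV :: int set))"
  have e: "bij_betw e UNIV UNIV"
    unfolding e_def by (rule bij_betw_from_nat_into) (auto simp: infinite_UNIV_int)
  then have inj: "inj e" by (simp add: bij_betw_def)
  have sums: "(\<lambda>i. if e i \<in> B then \<nu> {e i} else 0) sums \<nu> B" for B
  proof -
    \<comment> \<open>Atoms outside \<open>B\<close> are replaced by the empty set, so one family
      indexed by all naturals serves every \<open>B\<close>, finite or not.\<close>
    let ?A = "\<lambda>i. if e i \<in> B then {e i} else {}"
    have "disjoint_family ?A" using inj by (auto simp: disjoint_family_on_def inj_def)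
    then have "(\<lambda>i. \<nu> (?A i)) sums \<nu> (\<Union>i. ?A i)"
      using assms unfolding finite_signed_measure_def by blast
    moreover have "(\<Union>i. ?A i) = B" using e by (force simp: bij_betw_def surj_def split: if_splits)
    moreover have "\<nu> (?A i) = (if e i \<in> B then \<nu> {e i} else 0)" for i
      using finite_signed_measure_empty[OF assms] by simp
    ultimately show ?thesis by simp
  qed
  have "summable (\<lambda>i. (if e i \<in> {k. \<nu> {k} \<ge> 0} then \<nu> {e i} else 0) -
      (if e i \<in> {k. \<nu> {k} < 0} then \<nu> {e i} else 0))"
    by (intro summable_diff sums_summable[OF sums])
  also have "(\<lambda>i. (if e i \<in> {k. \<nu> {k} \<ge> 0} then \<nu> {e i} else 0) -
      (if e i \<in> {k. \<nu> {k} < 0} then \<nu> {e i} else 0)) = (\<lambda>i. norm (\<nu> {e i}))" by auto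
  finally have summ: "summable (\<lambda>i. norm (\<nu> {e i}))" .
  then have "(\<lambda>i. norm (\<nu> {e i})) summable_on UNIV"
    by (intro summable_nonneg_imp_summable_on) auto
  then show abs: "(\<lambda>k. norm (\<nu> {k})) summable_on UNIV"
    by (subst (asm) summable_on_reindex_bij_betw[OF e])
  have "((\<lambda>i. if e i \<in> A then \<nu> {e i} else 0) has_sum \<nu> A) UNIV"
  proof (rule norm_summable_imp_has_sum[OF summable_comparison_test' sums])
    show "summable (\<lambda>i. norm (\<nu> {e i}))" by fact
  qed auto
  then have "((\<lambda>k. if k \<in> A then \<nu> {k} else 0) has_sum \<nu> A) UNIV"
    by (subst (asm) has_sum_reindex_bij_betw[OF e])
  then show "((\<lambda>k. \<nu> {k}) has_sum \<nu> A) A"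
    by (rule has_sum_cong_neutral[THEN iffD1, rotated -1]) auto
qed

lemma finite_signed_measure_diff:
  "finite_signed_measure \<mu> \<Longrightarrow> finite_signed_measure \<nu> \<Longrightarrow> finite_signed_measure (\<lambda>A. \<mu> A - \<nu> A)"
  unfolding finite_signed_measure_def by (auto intro: sums_diff)

lemma finite_signed_measure_Un:
  assumes "finite_signed_measure \<nu>" "A \<inter> B = {}"
  shows "\<nu> (A \<union> B) = \<nu> A + \<nu> B"
  using has_sum_Un_disjoint[OF finite_signed_measure_has_sum(2)[OF assms(1), of A]
      finite_signed_measure_has_sum(2)[OF assms(1), of B] assms(2)]
    finite_signed_measure_has_sum(2)[OF assms(1), of "A \<union> B"] has_sum_unique by blast

lemma finite_signed_measure_atMost_step:
  assumes "finite_signed_measure \<nu>"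
  shows "\<nu> {j. j \<le> k} = \<nu> {j. j \<le> k - 1} + \<nu> {k}"
proof -
  have "{j. j \<le> k} = {j. j \<le> k - 1} \<union> {k}" by auto
  then show ?thesis using finite_signed_measure_Un[OF assms, of "{j. j \<le> k - 1}" "{k}"] by auto
qed

text \<open>The point masses at \<open>0, -1, -2, ...\<close> sum to the mass of the half-line up to
  \<open>0\<close>; the mass at or below \<open>- int n\<close> is a tail of this series.\<close>

lemma finite_signed_measure_atMost_tendsto_0:
  assumes "finite_signed_measure \<nu>"
  shows "(\<lambda>n::nat. \<nu> {j. j \<le> - int n}) \<longlonglongrightarrow> 0"
proof -
  let ?A = "\<lambda>n::nat. {- int n}"
  have "disjoint_family ?A" by (auto simp: disjoint_family_on_def)
  then have "(\<lambda>n. \<nu> (?A n)) sums \<nu> (\<Union>n. ?A n)"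
    using assms unfolding finite_signed_measure_def by blast
  also have "(\<Union>n. ?A n) = {j. j \<le> 0}" by (force intro!: exI[of _ "nat (- _)"])
  finally have "(\<lambda>n. \<Sum>i<n. \<nu> {- int i}) \<longlonglongrightarrow> \<nu> {j. j \<le> 0}" by (simp add: sums_def)
  moreover have "\<nu> {j. j \<le> - int n} = \<nu> {j. j \<le> 0} - (\<Sum>i<n. \<nu> {- int i})" for n
  proof (induction n)
    case (Suc n)
    have "- int (Suc n) = - int n - 1" by simp
    then show ?case using Suc finite_signed_measure_atMost_step[OF assms, of "- int n"]
      by (simp only: sum.lessThan_Suc)
  qed simp
  ultimately show ?thesis
    using tendsto_diff[OF tendsto_const[of "\<nu> {j. j \<le> 0}"],
        of "\<lambda>n. \<Sum>i<n. \<nu> {- int i}" "\<nu> {j. j \<le> 0}" sequentially] by simp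
qed

section \<open>Fourier transforms of signed measures\<close>

lemma fourier_Z_abs_summable:
  assumes "finite_signed_measure \<nu>"
  shows "(\<lambda>k. norm (of_real (\<nu> {k}) * exp (\<i> * of_int k * of_real \<xi>))) summable_on UNIV"
  using finite_signed_measure_has_sum(1)[OF assms] by (simp add: norm_mult)

lemma fourier_Z_has_sum:
  assumes "finite_signed_measure \<nu>"
  shows "((\<lambda>k. of_real (\<nu> {k}) * exp (\<i> * of_int k * of_real \<xi>)) has_sum fourier_Z \<nu> \<xi>) UNIV"
  unfolding fourier_Z_def
  by (rule has_sum_infsum[OF abs_summable_summable[OF fourier_Z_abs_summable[OF assms]]])

lemma fourier_Z_0: "finite_signed_measure \<nu> \<Longrightarrow> fourier_Z \<nu> 0 = of_real (\<nu> UNIV)"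
  using fourier_Z_has_sum[of \<nu> 0] has_sum_of_real[OF finite_signed_measure_has_sum(2)[of \<nu> UNIV]]
  by (auto dest: has_sum_unique)

lemma fourier_Z_diff:
  assumes "finite_signed_measure \<mu>" "finite_signed_measure \<nu>"
  shows "fourier_Z (\<lambda>A. \<mu> A - \<nu> A) \<xi> = fourier_Z \<mu> \<xi> - fourier_Z \<nu> \<xi>"
proof -
  have "((\<lambda>k. of_real (\<mu> {k} - \<nu> {k}) * exp (\<i> * of_int k * of_real \<xi>)) has_sum
      fourier_Z \<mu> \<xi> - fourier_Z \<nu> \<xi>) UNIV"
    using has_sum_add[OF fourier_Z_has_sum[OF assms(1)] has_sum_uminusI[OF fourier_Z_has_sum[OF assms(2)]]]
    by (simp add: algebra_simps)
  then show ?thesis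
    using fourier_Z_has_sum[OF finite_signed_measure_diff[OF assms]] by (auto dest: has_sum_unique)
qed

subsection \<open>The reference exponent\<close>

lemma finite_signed_measure_pmf: "finite_signed_measure (measure (measure_pmf (p :: int pmf)))"
  by (rule finite_signed_measure_measure) (auto intro: measure_pmf.finite_measure_axioms)

text \<open>With \<open>N\<close> the norm of the sum, \<open>(a + b)^2 - N^2\<close> equals twice
  the left side; it is also the product of \<open>a + b - N\<close> and \<open>a + b + N\<close>,
  and the latter is at most \<open>2\<close>.\<close>

lemma norm_two_phases:
  fixes a b \<alpha> \<beta> :: real
  assumes "0 \<le> a" "0 \<le> b" "a + b \<le> 1"
  shows "a * b * (1 - cos (\<alpha> - \<beta>)) \<le> a + b - norm (of_real a * cis \<alpha> + of_real b * cis \<beta>)"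
proof -
  define N where "N = norm (of_real a * cis \<alpha> + of_real b * cis \<beta>)"
  have "N \<le> norm (of_real a * cis \<alpha>) + norm (of_real b * cis \<beta>)"
    unfolding N_def by (rule norm_triangle_ineq)
  then have N: "0 \<le> N" "N \<le> a + b" using assms by (simp_all add: N_def norm_mult)
  have "N\<^sup>2 = (a * cos \<alpha> + b * cos \<beta>)\<^sup>2 + (a * sin \<alpha> + b * sin \<beta>)\<^sup>2"
    by (simp add: N_def cmod_power2)
  also have "\<dots> = a\<^sup>2 * ((sin \<alpha>)\<^sup>2 + (cos \<alpha>)\<^sup>2) + b\<^sup>2 * ((sin \<beta>)\<^sup>2 + (cos \<beta>)\<^sup>2) + 2 * a * b * cos (\<alpha> - \<beta>)"
    unfolding cos_diff power2_eq_square by algebra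
  finally have "2 * (a * b * (1 - cos (\<alpha> - \<beta>))) = (a + b)\<^sup>2 - N\<^sup>2"
    by (simp add: power2_eq_square algebra_simps)
  also have "\<dots> = (a + b - N) * (a + b + N)" by (simp add: power2_eq_square algebra_simps)
  also have "\<dots> \<le> (a + b - N) * 2" using N assms by (intro mult_left_mono) auto
  finally show ?thesis by (simp add: N_def)
qed

text \<open>Two atoms out of phase already cost modulus; the remaining mass contributes at most
  itself, so the total loss is at least that of the pair.\<close>

lemma fourier_Z_pmf_norm_gap:
  fixes p :: "int pmf"
  shows "pmf p x * pmf p y * (1 - cos (of_int (x - y) * \<xi>)) \<le> 1 - norm (fourier_Z (measure (measure_pmf p)) \<xi>)"
proof -
  let ?\<mu> = "measure (measure_pmf p)"
  let ?F = "\<lambda>k. of_real (?\<mu> {k}) * exp (\<i> * of_int k * of_real \<xi>) :: complex"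
  have normF: "norm (?F k) = ?\<mu> {k}" for k by (simp add: norm_mult)
  have gap: "norm (fourier_Z ?\<mu> \<xi>) \<le> norm (sum ?F A) + (1 - ?\<mu> A)" if "finite A" for A
  proof -
    have summ: "?F summable_on B" for B
      using summable_on_subset_banach[OF has_sum_imp_summable[OF fourier_Z_has_sum[OF finite_signed_measure_pmf]]]
      by blast
    have "fourier_Z ?\<mu> \<xi> = infsum ?F (A \<union> - A)" by (simp add: fourier_Z_def)
    also have "\<dots> = infsum ?F A + infsum ?F (- A)" by (rule infsum_Un_disjoint) (use summ in auto)
    also have "norm \<dots> \<le> norm (infsum ?F A) + norm (infsum ?F (- A))" by (rule norm_triangle_ineq)
    also have "norm (infsum ?F (- A)) \<le> ?\<mu> (- A)"
      by (rule norm_infsum_le[OF has_sum_infsum[OF summ] finite_signed_measure_has_sum(2)[OF finite_signed_measure_pmf]])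
         (simp only: normF order_refl)
    also have "?\<mu> (- A) = 1 - ?\<mu> A" using measure_pmf.prob_compl[of A p] by (simp add: Compl_eq_Diff_UNIV)
    finally show ?thesis using that by simp
  qed
  show ?thesis
  proof (cases "x = y")
    case True
    then show ?thesis using gap[of "{}"] by simp
  next
    case False
    have F: "?F k = of_real (pmf p k) * cis (of_int k * \<xi>)" for k
      by (simp add: measure_pmf_single cis_conv_exp mult_ac)
    have mu: "?\<mu> {x, y} = pmf p x + pmf p y"
      using False by (simp add: measure_measure_pmf_finite)
    have "norm (fourier_Z ?\<mu> \<xi>) \<le> norm (?F x + ?F y) + (1 - (pmf p x + pmf p y))"
      using gap[of "{x, y}"] False mu by simp
    moreover have "pmf p x + pmf p y \<le> 1" using mu measure_pmf.prob_le_1[of p "{x, y}"] by simp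
    ultimately show ?thesis
      using norm_two_phases[of "pmf p x" "pmf p y" "of_int x * \<xi>" "of_int y * \<xi>"]
      unfolding F by (simp add: algebra_simps)
  qed
qed

text \<open>The transform has modulus \<open>exp (Re (\<phi> \<xi>))\<close>, and
  \<open>exp t \<ge> 1 + t\<close> carries the gap from the modulus to the exponent.\<close>

lemma reference_exponent_Re_gap:
  assumes "reference_exponent p \<phi>"
  shows "pmf p x * pmf p y * (1 - cos (of_int (x - y) * \<xi>)) \<le> - Re (\<phi> \<xi>)"
proof -
  have "norm (fourier_Z (measure (measure_pmf p)) \<xi>) = exp (Re (\<phi> \<xi>))"
    using assms by (simp add: reference_exponent_def)
  then show ?thesis
    using fourier_Z_pmf_norm_gap[of p x y \<xi>] exp_ge_add_one_self[of "Re (\<phi> \<xi>)"] by linarith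
qed

section \<open>Subgroups of the integers and the support of an infinitely divisible law\<close>

lemma int_subgroup_eq_multiples:
  fixes S :: "int set"
  assumes "0 \<in> S" "\<And>a b. a \<in> S \<Longrightarrow> b \<in> S \<Longrightarrow> a - b \<in> S"
  shows "\<exists>d::nat. S = range (\<lambda>j. int d * j)"
proof (cases "S = {0}")
  case True
  then show ?thesis by (intro exI[of _ 0]) auto
next
  case False
  have neg: "- a \<in> S" if "a \<in> S" for a using assms(2)[OF assms(1) that] by simp
  have add: "a + b \<in> S" if "a \<in> S" "b \<in> S" for a b using assms(2)[OF that(1) neg[OF that(2)]] by simp
  have mulnat: "int n * a \<in> S" if "a \<in> S" for n a
    by (induction n) (use assms(1) add[OF that] in \<open>auto simp: distrib_right\<close>)
  have mul: "j * a \<in> S" if "a \<in> S" for j a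
    using mulnat[OF that, of "nat j"] neg[OF mulnat[OF that, of "nat (- j)"]] by (cases "j \<ge> 0") auto
  obtain a where "a \<in> S" "a \<noteq> 0" using False assms(1) by blast
  then have "\<exists>n>0. int n \<in> S"
    using neg[of a] by (intro exI[of _ "nat \<bar>a\<bar>"]) (auto simp: abs_if)
  \<comment> \<open>Euclidean division by the least positive element: the remainder lies in
    \<open>S\<close> and is below \<open>d\<close>, hence zero.\<close>
  define d where "d = (LEAST n. n > 0 \<and> int n \<in> S)"
  have d: "d > 0" "int d \<in> S"
    using LeastI_ex[of "\<lambda>n. n > 0 \<and> int n \<in> S"] \<open>\<exists>n>0. int n \<in> S\<close> unfolding d_def by auto
  have "x \<in> range (\<lambda>j. int d * j)" if "x \<in> S" for x
  proof -
    have "x mod int d = x - (x div int d) * int d" by (simp add: minus_div_mult_eq_mod)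
    also have "\<dots> \<in> S" by (intro assms(2) mul that d)
    finally have "x mod int d \<in> S" .
    moreover have "\<not> (nat (x mod int d) > 0 \<and> int (nat (x mod int d)) \<in> S)"
    proof (rule not_less_Least[of _ "\<lambda>n. n > 0 \<and> int n \<in> S", folded d_def])
      show "nat (x mod int d) < d" using d pos_mod_bound[of "int d" x] pos_mod_sign[of "int d" x] by linarith
    qed
    ultimately have "\<not> 0 < x mod int d" by simp
    moreover have "0 \<le> x mod int d" using d by simp
    ultimately have "x mod int d = 0" by linarith
    then show ?thesis by (auto simp: mod_eq_0_iff_dvd dvd_def)
  qed
  moreover have "int d * j \<in> S" for j using mul[OF d(2), of j] by (simp add: mult.commute)
  ultimately show ?thesis by (intro exI[of _ d]) auto
qed

text \<open>If \<open>p\<close> is the \<open>d\<close>-th convolution power of \<open>q\<close>, then \<open>d b\<close> lies in the support of \<open>p\<close> for \<open>b\<close> in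
  that of \<open>q\<close>; with \<open>S = d \<int>\<close> this puts the whole coset containing the support inside \<open>S\<close>.\<close>

lemma infinitely_divisible_support_subgroup:
  assumes "infinitely_divisible_Z p" "0 \<in> S" "\<And>a b. a \<in> S \<Longrightarrow> b \<in> S \<Longrightarrow> a - b \<in> S"
    and "\<And>x y. x \<in> set_pmf p \<Longrightarrow> y \<in> set_pmf p \<Longrightarrow> x - y \<in> S"
  shows "set_pmf p \<subseteq> S"
proof
  fix x assume x: "x \<in> set_pmf p"
  obtain d where S: "S = range (\<lambda>j. int d * j)" using int_subgroup_eq_multiples[OF assms(2,3)] by blast
  \<comment> \<open>When \<open>d = 0\<close>, the set \<open>S\<close> is trivial and
    \<open>x\<close> must equal \<open>n * b\<close>; taking \<open>n\<close> larger than
    \<open>\<bar>x\<bar>\<close> leaves only \<open>b = 0\<close>.\<close>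
  define n where "n = (if d = 0 then nat \<bar>x\<bar> + 1 else d)"
  have n: "n > 0" by (auto simp: n_def)
  then obtain q where q: "p = map_pmf sum_list (replicate_pmf n q)"
    using assms(1) unfolding infinitely_divisible_Z_def by blast
  have supp: "set_pmf p = sum_list ` {xs \<in> lists (set_pmf q). length xs = n}"
    by (simp add: q set_replicate_pmf)
  obtain b where b: "b \<in> set_pmf q" using set_pmf_not_empty[of q] by blast
  have "int n * b \<in> set_pmf p"
    unfolding supp by (rule image_eqI[of _ _ "replicate n b"]) (use b in \<open>auto simp: sum_list_replicate\<close>)
  with assms(4)[OF x this] obtain j where j: "x - int n * b = int d * j" unfolding S by blast
  show "x \<in> S"
  proof (cases "d = 0")
    case True
    then have "x = (1 + \<bar>x\<bar>) * b" using j by (simp add: n_def)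
    then have eq: "\<bar>x\<bar> = (1 + \<bar>x\<bar>) * \<bar>b\<bar>" using abs_mult[of "1 + \<bar>x\<bar>" b] by simp
    have "b = 0"
    proof (rule ccontr)
      assume "b \<noteq> 0"
      then have "(1 + \<bar>x\<bar>) * 1 \<le> (1 + \<bar>x\<bar>) * \<bar>b\<bar>" by (intro mult_left_mono) auto
      then show False using eq by simp
    qed
    with \<open>x = (1 + \<bar>x\<bar>) * b\<close> show ?thesis using assms(2) by simp
  next
    case False
    then have "x = int d * (b + j)" using j by (simp add: n_def algebra_simps)
    then show ?thesis unfolding S by blast
  qed
qed

text \<open>The integers \<open>j\<close> with \<open>j * \<xi>\<close> a multiple of
  \<open>2 * pi\<close> form a subgroup. Without decay at \<open>\<xi>\<close>, the gap estimate
  puts all differences of support points there, infinite divisibility then puts the support itself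
  there, and the lattice condition makes the subgroup contain \<open>1\<close>.\<close>

lemma reference_exponent_Re_eq_0:
  assumes "reference_exponent p \<phi>" "Re (\<phi> \<xi>) \<ge> 0"
  shows "cos \<xi> = 1"
proof -
  define S where "S = {j::int. \<exists>n::int. of_int j * \<xi> = of_int n * (2 * pi)}"
  have "0 \<in> S" by (auto simp: S_def)
  moreover have sub: "a - b \<in> S" if ab: "a \<in> S" "b \<in> S" for a b
  proof -
    obtain i j :: int where "of_int a * \<xi> = of_int i * (2 * pi)" "of_int b * \<xi> = of_int j * (2 * pi)"
      using ab unfolding S_def by blast
    then have "of_int (a - b) * \<xi> = of_int (i - j) * (2 * pi)" by (simp add: left_diff_distrib)
    then show ?thesis unfolding S_def by blast
  qed
  moreover have "x - y \<in> S" if "x \<in> set_pmf p" "y \<in> set_pmf p" for x y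
  proof -
    have "0 < pmf p x * pmf p y" using that by (simp add: pmf_positive)
    moreover have "pmf p x * pmf p y * (1 - cos (of_int (x - y) * \<xi>)) \<le> 0"
      using reference_exponent_Re_gap[OF assms(1), of x y \<xi>] assms(2) by linarith
    ultimately have "1 - cos (of_int (x - y) * \<xi>) \<le> 0" by (meson mult_pos_pos not_le)
    then have "cos (of_int (x - y) * \<xi>) = 1"
      using cos_le_one[of "of_int (x - y) * \<xi>"] by linarith
    then show ?thesis unfolding S_def cos_one_2pi_int by (simp add: mult.assoc)
  qed
  ultimately have "set_pmf p \<subseteq> S"
    using infinitely_divisible_support_subgroup[of p S] assms(1) by (auto simp: reference_exponent_def)
  moreover obtain d :: nat where d: "S = range (\<lambda>j. int d * j)"
    using int_subgroup_eq_multiples[OF \<open>0 \<in> S\<close> sub] by blast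
  ultimately have "d = 1" using assms(1) by (simp add: reference_exponent_def no_proper_sublattice_def)
  then have "1 \<in> S" using d by simp
  then show ?thesis by (auto simp: S_def cos_one_2pi_int mult.assoc)
qed

text \<open>Two distinct atoms bound \<open>- Re (\<phi> \<xi>)\<close> below by a positive multiple
  of \<open>\<xi>^2\<close> near zero, whereas a vanishing \<open>\<sigma>\<close> would make it
  \<open>o(\<xi>^2)\<close>.\<close>

lemma reference_exponent_sigma_nonzero:
  assumes ref: "reference_exponent p \<phi>"
    and o: "(\<lambda>\<xi>. \<phi> \<xi> - (\<i> * of_real (m * \<xi>) - of_real (\<sigma>\<^sup>2 * \<xi>\<^sup>2 / 2))) \<in> o[at 0](\<lambda>\<xi>. of_real (\<xi>\<^sup>2))"
  shows "\<sigma> \<noteq> 0"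
proof
  assume "\<sigma> = 0"
  \<comment> \<open>A single atom would have all differences in \<open>{0}\<close>, hence sit at
    \<open>0\<close>, inside the sublattice with \<open>d = 0\<close>.\<close>
  have "\<exists>x y. x \<in> set_pmf p \<and> y \<in> set_pmf p \<and> x \<noteq> y"
  proof (rule ccontr)
    assume "\<not> ?thesis"
    then have "x - y \<in> {0}" if "x \<in> set_pmf p" "y \<in> set_pmf p" for x y using that by auto
    then have "set_pmf p \<subseteq> {0}"
      using ref by (intro infinitely_divisible_support_subgroup) (auto simp: reference_exponent_def)
    then have "set_pmf p \<subseteq> range (\<lambda>j. int 0 * j)" by auto
    moreover have "no_proper_sublattice p" using ref by (simp add: reference_exponent_def)
    ultimately have "0 = (1::nat)" unfolding no_proper_sublattice_def by (elim allE impE)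
    then show False by simp
  qed
  then obtain x y where xy: "x \<in> set_pmf p" "y \<in> set_pmf p" "x \<noteq> y" by blast
  define c where "c = pmf p x * pmf p y"
  define t where "t = real_of_int (x - y)"
  have c: "c > 0" using xy by (simp add: c_def pmf_positive)
  have t: "t \<noteq> 0" using xy by (simp add: t_def)
  have "((\<lambda>\<xi>. (\<phi> \<xi> - \<i> * of_real (m * \<xi>)) / of_real (\<xi>\<^sup>2)) \<longlongrightarrow> 0) (at 0)"
    using smalloD_tendsto[OF o] by (simp add: \<open>\<sigma> = 0\<close>)
  from tendsto_Re[OF this] have "((\<lambda>\<xi>. - Re (\<phi> \<xi>) / \<xi>\<^sup>2) \<longlongrightarrow> - 0) (at 0)"
    by (intro tendsto_minus[THEN tendsto_cong[THEN iffD1, rotated]]) (auto simp: Re_divide_of_real simp del: of_real_power)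
  moreover have "((\<lambda>\<xi>. c * (1 - cos (t * \<xi>)) / \<xi>\<^sup>2) \<longlongrightarrow> c * (t\<^sup>2 / 2)) (at 0)"
  proof -
    \<comment> \<open>By the half-angle formula
      \<open>1 - cos (t * \<xi>) = 2 * (sin (t / 2 * \<xi>))^2\<close>, the limit comes down to the
      derivative of a sine at zero.\<close>
    have "((\<lambda>\<xi>. sin (t / 2 * \<xi>)) has_real_derivative t / 2) (at 0)"
      by (auto intro!: derivative_eq_intros)
    then have "((\<lambda>\<xi>. sin (t / 2 * \<xi>) / \<xi>) \<longlongrightarrow> t / 2) (at 0)" by (simp add: DERIV_def)
    from tendsto_mult[OF tendsto_const[of "2 * c"] tendsto_power[OF this, of 2]]
    have "((\<lambda>\<xi>. 2 * c * (sin (t / 2 * \<xi>) / \<xi>)\<^sup>2) \<longlongrightarrow> 2 * c * (t / 2)\<^sup>2) (at 0)" .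
    moreover have "2 * c * (sin (t / 2 * \<xi>) / \<xi>)\<^sup>2 = c * (1 - cos (t * \<xi>)) / \<xi>\<^sup>2" for \<xi>
      using cos_double_sin[of "t / 2 * \<xi>"] by (simp add: power_divide)
    moreover have "2 * c * (t / 2)\<^sup>2 = c * (t\<^sup>2 / 2)" by (simp add: power_divide)
    ultimately show ?thesis by simp
  qed
  moreover have "\<forall>\<^sub>F \<xi> in at 0. c * (1 - cos (t * \<xi>)) / \<xi>\<^sup>2 \<le> - Re (\<phi> \<xi>) / \<xi>\<^sup>2"
    using reference_exponent_Re_gap[OF ref, of x y]
    by (intro always_eventually allI divide_right_mono) (auto simp: c_def t_def)
  ultimately have "c * (t\<^sup>2 / 2) \<le> - 0" by (intro tendsto_le[OF at_neq_bot])
  then show False using c t by (simp add: mult_le_0_iff not_le)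
qed

text \<open>Near the origin the expansion gives the bound; away from it, up to \<open>pi\<close>,
  the real part has a negative maximum on a compact set.\<close>

lemma reference_exponent_Re_bound:
  assumes ref: "reference_exponent p \<phi>"
    and o: "(\<lambda>\<xi>. \<phi> \<xi> - (\<i> * of_real (m * \<xi>) - of_real (\<sigma>\<^sup>2 * \<xi>\<^sup>2 / 2))) \<in> o[at 0](\<lambda>\<xi>. of_real (\<xi>\<^sup>2))"
  obtains c where "c > 0" "\<And>\<xi>. \<bar>\<xi>\<bar> \<le> pi \<Longrightarrow> Re (\<phi> \<xi>) \<le> - c * \<xi>\<^sup>2"
proof -
  \<comment> \<open>Half of the coefficient \<open>\<sigma>^2 / 2\<close> is given up to absorb the
    remainder.\<close>
  have s: "\<sigma>\<^sup>2 / 4 > 0" using reference_exponent_sigma_nonzero[OF assms] by simp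
  have "\<forall>\<^sub>F \<xi> in at 0. norm (\<phi> \<xi> - (\<i> * of_real (m * \<xi>) - of_real (\<sigma>\<^sup>2 * \<xi>\<^sup>2 / 2))) \<le> \<sigma>\<^sup>2 / 4 * norm (of_real (\<xi>\<^sup>2) :: complex)"
    by (rule landau_o.smallD[OF o s])
  then obtain \<delta> where \<delta>: "\<delta> > 0" and near: "\<And>\<xi>. \<xi> \<noteq> 0 \<Longrightarrow> \<bar>\<xi>\<bar> < \<delta> \<Longrightarrow>
      norm (\<phi> \<xi> - (\<i> * of_real (m * \<xi>) - of_real (\<sigma>\<^sup>2 * \<xi>\<^sup>2 / 2))) \<le> \<sigma>\<^sup>2 / 4 * \<xi>\<^sup>2"
    unfolding eventually_at by (auto simp: dist_real_def simp del: of_real_power)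
  have near': "Re (\<phi> \<xi>) \<le> - (\<sigma>\<^sup>2 / 4) * \<xi>\<^sup>2" if "\<xi> \<noteq> 0" "\<bar>\<xi>\<bar> < \<delta>" for \<xi>
  proof -
    have "Re (\<phi> \<xi>) + \<sigma>\<^sup>2 * \<xi>\<^sup>2 / 2 = Re (\<phi> \<xi> - (\<i> * of_real (m * \<xi>) - of_real (\<sigma>\<^sup>2 * \<xi>\<^sup>2 / 2)))"
      by (simp del: of_real_power)
    also have "\<dots> \<le> \<sigma>\<^sup>2 / 4 * \<xi>\<^sup>2" using near[OF that] complex_Re_le_cmod order_trans by blast
    finally show ?thesis by simp
  qed
  define K where "K = {- pi..pi} \<inter> {\<xi>. \<delta> \<le> \<bar>\<xi>\<bar>}"
  have "\<exists>c>0. \<forall>\<xi>\<in>K. Re (\<phi> \<xi>) \<le> - c * \<xi>\<^sup>2"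
  proof (cases "K = {}")
    case True
    then show ?thesis by (intro exI[of _ 1]) auto
  next
    case False
    have "closed {\<xi>::real. \<delta> \<le> \<bar>\<xi>\<bar>}" by (intro closed_Collect_le continuous_intros)
    then have "compact K" unfolding K_def by (intro compact_Int_closed) auto
    moreover have "continuous_on K (\<lambda>\<xi>. Re (\<phi> \<xi>))"
      using ref by (auto simp: reference_exponent_def intro!: continuous_intros intro: continuous_on_subset)
    ultimately obtain z where z: "z \<in> K" "\<And>\<xi>. \<xi> \<in> K \<Longrightarrow> Re (\<phi> \<xi>) \<le> Re (\<phi> z)"
      using continuous_attains_sup[OF _ False] by metis
    have "Re (\<phi> z) < 0"
    proof (rule ccontr)
      assume "\<not> ?thesis"
      then have "cos z = 1" using reference_exponent_Re_eq_0[OF ref, of z] by simp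
      then have "cos \<bar>z\<bar> = cos 0" by simp
      moreover have "\<bar>z\<bar> \<le> pi" "z \<noteq> 0" using z(1) \<delta> by (auto simp: K_def)
      ultimately show False using cos_inj_pi[of "\<bar>z\<bar>" 0] by simp
    qed
    \<comment> \<open>As \<open>\<xi>^2 \<le> pi^2\<close> on \<open>K\<close>, this factor turns
      the constant bound \<open>Re (\<phi> z)\<close> into a quadratic one.\<close>
    define c where "c = - Re (\<phi> z) / pi\<^sup>2"
    have "c > 0" using \<open>Re (\<phi> z) < 0\<close> unfolding c_def by (intro divide_pos_pos) auto
    moreover have "Re (\<phi> \<xi>) \<le> - c * \<xi>\<^sup>2" if "\<xi> \<in> K" for \<xi>
    proof -
      have "\<bar>\<xi>\<bar> \<le> pi" using that by (auto simp: K_def)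
      then have "\<xi>\<^sup>2 \<le> pi\<^sup>2" by (simp add: abs_le_square_iff[symmetric])
      then have "c * \<xi>\<^sup>2 \<le> c * pi\<^sup>2" using \<open>c > 0\<close> by (intro mult_left_mono) auto
      also have "\<dots> = - Re (\<phi> z)" by (simp add: c_def)
      finally show ?thesis using z(2)[OF that] by simp
    qed
    ultimately show ?thesis by blast
  qed
  then obtain c where c: "c > 0" "\<And>\<xi>. \<xi> \<in> K \<Longrightarrow> Re (\<phi> \<xi>) \<le> - c * \<xi>\<^sup>2" by blast
  show thesis
  proof (rule that[of "min c (\<sigma>\<^sup>2 / 4)"])
    show "min c (\<sigma>\<^sup>2 / 4) > 0" using c s by simp
    fix \<xi> assume "\<bar>\<xi>\<bar> \<le> pi"
    have "Re (\<phi> \<xi>) \<le> - c * \<xi>\<^sup>2 \<or> Re (\<phi> \<xi>) \<le> - (\<sigma>\<^sup>2 / 4) * \<xi>\<^sup>2"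
    proof (cases "\<xi> = 0")
      case True
      then show ?thesis using ref by (simp add: reference_exponent_def)
    next
      case False
      then show ?thesis using near'[of \<xi>] c(2)[of \<xi>] \<open>\<bar>\<xi>\<bar> \<le> pi\<close>
        by (cases "\<bar>\<xi>\<bar> < \<delta>") (auto simp: K_def abs_le_iff)
    qed
    moreover have "min c (\<sigma>\<^sup>2 / 4) * \<xi>\<^sup>2 \<le> c * \<xi>\<^sup>2" "min c (\<sigma>\<^sup>2 / 4) * \<xi>\<^sup>2 \<le> \<sigma>\<^sup>2 / 4 * \<xi>\<^sup>2"
      by (intro mult_right_mono; simp)+
    ultimately show "Re (\<phi> \<xi>) \<le> - min c (\<sigma>\<^sup>2 / 4) * \<xi>\<^sup>2" by force
  qed
qed

subsection \<open>Fourier inversion\<close>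

lemma integral_circle_character:
  "(LINT \<xi>:{-pi..pi}|lborel. exp (\<i> * of_int j * of_real \<xi>)) = (if j = 0 then of_real (2 * pi) else 0)"
proof (cases "j = 0")
  case True
  then show ?thesis by (simp add: set_lebesgue_integral_def scaleR_conv_of_real)
next
  case False
  define F where "F \<xi> = exp (\<i> * of_int j * of_real \<xi>) / (\<i> * of_int j)" for \<xi> :: real
  have "(LINT \<xi>:{-pi..pi}|lborel. exp (\<i> * of_int j * of_real \<xi>)) = F pi - F (- pi)"
    unfolding set_lebesgue_integral_def
  proof (rule integral_FTC_Icc)
    fix x :: real
    have "((\<lambda>z. exp (\<i> * of_int j * z) / (\<i> * of_int j)) has_field_derivative exp (\<i> * of_int j * of_real x)) (at (of_real x))"
      using False by (auto intro!: derivative_eq_intros)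
    from has_vector_derivative_real_field[OF this]
    show "(F has_vector_derivative exp (\<i> * of_int j * of_real x)) (at x within {-pi..pi})"
      unfolding F_def by (rule has_vector_derivative_at_within)
  qed (auto intro!: continuous_intros)
  also have "F pi - F (- pi) = 0"
  proof -
    have "\<i> * of_int j * of_real pi = \<i> * of_int j * of_real (- pi) + \<i> * (of_int j * (of_real pi * 2))"
      by (simp add: algebra_simps)
    then have "exp (\<i> * of_int j * of_real pi) = exp (\<i> * of_int j * of_real (- pi))"
      by (simp only: exp_add exp_2pi_1_int mult_1_right)
    then show ?thesis by (simp only: F_def diff_self)
  qed
  finally show ?thesis using False by simp
qed

text \<open>Unordered sums become series along an enumeration, the form in which measurability and
  termwise integration apply.\<close>

lemma fourier_Z_sums:
  assumes "finite_signed_measure \<nu>" "bij_betw e (UNIV :: nat set) (UNIV :: int set)"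
  shows "(\<lambda>i. of_real (\<nu> {e i}) * exp (\<i> * of_int (e i) * of_real \<xi>)) sums fourier_Z \<nu> \<xi>"
  using fourier_Z_has_sum[OF assms(1), of \<xi>]
  by (intro has_sum_imp_sums) (subst has_sum_reindex_bij_betw[OF assms(2), of "\<lambda>k. of_real (\<nu> {k}) * exp (\<i> * of_int k * of_real \<xi>)"])

lemma int_enumeration: obtains e where "bij_betw e (UNIV :: nat set) (UNIV :: int set)"
  using bij_betw_from_nat_into[of "UNIV :: int set"] by (auto simp: infinite_UNIV_int)

lemma borel_measurable_fourier_Z [measurable]:
  assumes "finite_signed_measure \<nu>"
  shows "fourier_Z \<nu> \<in> borel_measurable borel"
proof -
  obtain e where e: "bij_betw e (UNIV :: nat set) (UNIV :: int set)" by (rule int_enumeration)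
  have "fourier_Z \<nu> = (\<lambda>\<xi>. \<Sum>i. of_real (\<nu> {e i}) * exp (\<i> * of_int (e i) * of_real \<xi>))"
    using fourier_Z_sums[OF assms e] by (auto simp: sums_iff)
  then show ?thesis by simp
qed

text \<open>Absolute summability of the atoms permits integrating term by term, and orthogonality of
  the characters on the circle keeps only the atom at \<open>k\<close>.\<close>

theorem fourier_Z_inversion:
  assumes "finite_signed_measure \<nu>"
  shows "(LINT \<xi>:{-pi..pi}|lborel. fourier_Z \<nu> \<xi> * exp (- \<i> * of_int k * of_real \<xi>)) = of_real (2 * pi * \<nu> {k})"
proof -
  obtain e where e: "bij_betw e (UNIV :: nat set) (UNIV :: int set)" by (rule int_enumeration)
  define g where "g i \<xi> = indicator {-pi..pi} \<xi> *\<^sub>R (of_real (\<nu> {e i}) * exp (\<i> * of_int (e i - k) * of_real \<xi>))" for i and \<xi> :: real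
  have normg: "norm (g i \<xi>) = indicator {-pi..pi} \<xi> * \<bar>\<nu> {e i}\<bar>" for i \<xi>
    by (simp add: g_def norm_mult)
  have summ: "summable (\<lambda>i. \<bar>\<nu> {e i}\<bar>)"
    using finite_signed_measure_has_sum(1)[OF assms] summable_on_reindex_bij_betw[OF e, of "\<lambda>k. norm (\<nu> {k})"]
    by (auto dest: summable_on_imp_summable)
  have int: "integrable lborel (g i)" for i
    unfolding g_def by (rule borel_integrable_compact) (auto intro!: continuous_intros)
  have "(\<lambda>i. integral\<^sup>L lborel (g i)) sums (\<integral>\<xi>. (\<Sum>i. g i \<xi>) \<partial>lborel)"
  proof (rule sums_integral[OF int])
    show "AE \<xi> in lborel. summable (\<lambda>i. norm (g i \<xi>))"
      unfolding normg by (intro AE_I2 summable_mult summ)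
    show "summable (\<lambda>i. \<integral>\<xi>. norm (g i \<xi>) \<partial>lborel)"
      unfolding normg using summable_mult[OF summ, of "2 * pi"] by simp
  qed
  moreover have "integral\<^sup>L lborel (g i) = of_real (\<nu> {e i}) * (if e i = k then of_real (2 * pi) else 0)" for i
    using integral_circle_character[of "e i - k"]
    by (simp only: g_def[abs_def] set_lebesgue_integral_def mult_scaleR_right[symmetric] integral_mult_right_zero)
      simp
  moreover have "(\<Sum>i. g i \<xi>) = indicator {-pi..pi} \<xi> *\<^sub>R (fourier_Z \<nu> \<xi> * exp (- \<i> * of_int k * of_real \<xi>))" for \<xi>
  proof -
    have "(\<lambda>i. indicator {-pi..pi} \<xi> *\<^sub>R (of_real (\<nu> {e i}) * exp (\<i> * of_int (e i) * of_real \<xi>) * exp (- \<i> * of_int k * of_real \<xi>)))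
       sums (indicator {-pi..pi} \<xi> *\<^sub>R (fourier_Z \<nu> \<xi> * exp (- \<i> * of_int k * of_real \<xi>)))"
      by (intro sums_scaleR_right sums_mult2 fourier_Z_sums assms e)
    moreover have "(\<lambda>i. indicator {-pi..pi} \<xi> *\<^sub>R (of_real (\<nu> {e i}) * exp (\<i> * of_int (e i) * of_real \<xi>) * exp (- \<i> * of_int k * of_real \<xi>))) = (\<lambda>i. g i \<xi>)"
      by (simp add: g_def fun_eq_iff mult.assoc exp_add[symmetric] algebra_simps)
    ultimately show ?thesis by (simp add: sums_iff)
  qed
  ultimately have s: "(\<lambda>i. of_real (\<nu> {e i}) * (if e i = k then of_real (2 * pi) else 0)) sums
      (LINT \<xi>:{-pi..pi}|lborel. fourier_Z \<nu> \<xi> * exp (- \<i> * of_int k * of_real \<xi>))"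
    by (simp add: set_lebesgue_integral_def)
  obtain i0 where i0: "e i0 = k" using e by (metis bij_betw_def surjD)
  have eq: "e i = k \<longleftrightarrow> i = i0" for i using e i0 by (metis bij_betw_def injD)
  have "(\<lambda>i. of_real (\<nu> {e i}) * (if e i = k then of_real (2 * pi) else 0)) =
     (\<lambda>i. if i = i0 then complex_of_real (2 * pi * \<nu> {k}) else 0)"
    unfolding eq using i0 by (auto simp: fun_eq_iff mult.commute)
  then show ?thesis using s sums_single[of i0 "\<lambda>_. complex_of_real (2 * pi * \<nu> {k})"] by (simp add: sums_iff)
qed

text \<open>Dividing by \<open>1 - e\<^sup>i\<^sup>\<xi>\<close> turns point masses into cumulative masses, up to a constant
  which depends on the behaviour at \<open>-\<infinity>\<close>.\<close>

lemma cumulative_fourier_inversion: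
  assumes \<nu>: "finite_signed_measure \<nu>" "\<nu> UNIV = 0"
    and int: "set_integrable lborel {-pi..pi} (\<lambda>\<xi>. fourier_Z \<nu> \<xi> / (1 - exp (\<i> * of_real \<xi>)))"
  obtains g where "\<And>k. of_real (2 * pi * \<nu> {j. j \<le> k}) =
    (LINT \<xi>:{-pi..pi}|lborel. fourier_Z \<nu> \<xi> / (1 - exp (\<i> * of_real \<xi>)) * exp (- \<i> * of_int k * of_real \<xi>)) + g"
proof -
  define q where "q \<xi> = fourier_Z \<nu> \<xi> / (1 - exp (\<i> * of_real \<xi>))" for \<xi> :: real
  define f where "f k = (LINT \<xi>:{-pi..pi}|lborel. q \<xi> * exp (- \<i> * of_int k * of_real \<xi>))" for k :: int
  \<comment> \<open>The discrepancy between the two sides. Multiplying \<open>q\<close> by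
    \<open>1 - exp (\<i> * \<xi>)\<close> amounts to the backward difference of \<open>f\<close> in
    \<open>k\<close>, so \<open>d\<close> does not change from \<open>k - 1\<close> to
    \<open>k\<close>.\<close>
  define d where "d k = of_real (2 * pi * \<nu> {j. j \<le> k}) - f k" for k
  have intk: "set_integrable lborel {-pi..pi} (\<lambda>\<xi>. q \<xi> * exp (- \<i> * of_int k * of_real \<xi>))" for k :: int
    unfolding set_integrable_def
  proof (rule Bochner_Integration.integrable_bound[OF int[unfolded set_integrable_def, folded q_def]])
    have "(\<lambda>\<xi>. indicator {-pi..pi} \<xi> *\<^sub>R q \<xi>) \<in> borel_measurable lborel"
      using int unfolding set_integrable_def q_def by (rule borel_measurable_integrable)
    then have "(\<lambda>\<xi>. (indicator {-pi..pi} \<xi> *\<^sub>R q \<xi>) * exp (- \<i> * of_int k * of_real \<xi>)) \<in> borel_measurable lborel"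
      by (rule borel_measurable_times) simp
    then show "(\<lambda>\<xi>. indicator {-pi..pi} \<xi> *\<^sub>R (q \<xi> * exp (- \<i> * of_int k * of_real \<xi>))) \<in> borel_measurable lborel"
      by simp
    show "AE \<xi> in lborel. norm (indicator {-pi..pi} \<xi> *\<^sub>R (q \<xi> * exp (- \<i> * of_int k * of_real \<xi>))) \<le>
        norm (indicator {-pi..pi} \<xi> *\<^sub>R q \<xi>)"
      by (intro AE_I2) (simp add: norm_mult)
  qed
  have step: "d k = d (k - 1)" for k
  proof -
    have "f k - f (k - 1) = (LINT \<xi>:{-pi..pi}|lborel.
        q \<xi> * exp (- \<i> * of_int k * of_real \<xi>) - q \<xi> * exp (- \<i> * of_int (k - 1) * of_real \<xi>))"
      unfolding f_def by (rule set_integral_diff(2)[symmetric]) (rule intk)+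
    also have "\<dots> = (LINT \<xi>:{-pi..pi}|lborel. fourier_Z \<nu> \<xi> * exp (- \<i> * of_int k * of_real \<xi>))"
    proof (rule set_lebesgue_integral_cong)
      show "\<forall>\<xi>. \<xi> \<in> {-pi..pi} \<longrightarrow> q \<xi> * exp (- \<i> * of_int k * of_real \<xi>) - q \<xi> * exp (- \<i> * of_int (k - 1) * of_real \<xi>) =
        fourier_Z \<nu> \<xi> * exp (- \<i> * of_int k * of_real \<xi>)"
      proof (intro allI impI)
        fix \<xi> :: real assume \<xi>: "\<xi> \<in> {-pi..pi}"
        have "exp (- \<i> * of_int (k - 1) * of_real \<xi>) = exp (- \<i> * of_int k * of_real \<xi>) * exp (\<i> * of_real \<xi>)"
          by (simp add: exp_add[symmetric] algebra_simps)
        then have "q \<xi> * exp (- \<i> * of_int k * of_real \<xi>) - q \<xi> * exp (- \<i> * of_int (k - 1) * of_real \<xi>) =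
          q \<xi> * (1 - exp (\<i> * of_real \<xi>)) * exp (- \<i> * of_int k * of_real \<xi>)" by (simp add: algebra_simps)
        \<comment> \<open>At \<open>\<xi> = 0\<close> both sides are zero, the transform because the
          total mass is; elsewhere in the interval the denominator does not vanish.\<close>
        also have "q \<xi> * (1 - exp (\<i> * of_real \<xi>)) = fourier_Z \<nu> \<xi>"
        proof (cases "\<xi> = 0")
          case True
          then show ?thesis using fourier_Z_0[OF \<nu>(1)] \<nu>(2) by simp
        next
          case False
          have "exp (\<i> * of_real \<xi>) \<noteq> 1"
          proof
            assume "exp (\<i> * of_real \<xi>) = 1"
            then have "cis \<xi> = 1" by (simp add: cis_conv_exp)
            then have "cos \<bar>\<xi>\<bar> = cos 0" by (simp add: complex_eq_iff)
            then show False using cos_inj_pi[of "\<bar>\<xi>\<bar>" 0] \<xi> False by (simp add: abs_le_iff)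
          qed
          then show ?thesis by (simp add: q_def)
        qed
        finally show "q \<xi> * exp (- \<i> * of_int k * of_real \<xi>) - q \<xi> * exp (- \<i> * of_int (k - 1) * of_real \<xi>) =
          fourier_Z \<nu> \<xi> * exp (- \<i> * of_int k * of_real \<xi>)" .
      qed
    qed simp
    also have "\<dots> = of_real (2 * pi * \<nu> {k})" by (rule fourier_Z_inversion[OF \<nu>(1)])
    finally have "f k - f (k - 1) = of_real (2 * pi * \<nu> {k})" .
    moreover have "\<nu> {j. j \<le> k} = \<nu> {j. j \<le> k - 1} + \<nu> {k}"
      by (rule finite_signed_measure_atMost_step[OF \<nu>(1)])
    ultimately show ?thesis by (simp only: d_def) (simp add: algebra_simps)
  qed
  have "d k = d 0" for k
    by (induction k rule: int_induct[of _ 0]) (use step[of "_ + 1"] step in auto)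
  then have "of_real (2 * pi * \<nu> {j. j \<le> k}) = f k + d 0" for k
    by (metis d_def diff_add_cancel add.commute)
  then show thesis using that unfolding f_def q_def by blast
qed

subsection \<open>Local limit\<close>

text \<open>The norm is \<open>2 * sin (\<bar>\<xi>\<bar> / 2)\<close>, and
  \<open>sin x \<ge> x / 2\<close> up to \<open>pi / 2\<close>: until \<open>pi / 3\<close> because
  the cosine stays above \<open>1 / 2\<close>, afterwards because
  \<open>sin x \<ge> sqrt 3 / 2 \<ge> 0.85\<close>, which exceeds \<open>pi / 4\<close>.\<close>

lemma norm_1_minus_exp_i_lower:
  assumes "\<bar>\<xi>\<bar> \<le> pi"
  shows "\<bar>\<xi>\<bar> / 2 \<le> norm (1 - exp (\<i> * of_real \<xi>))"
proof -
  define x where "x = \<bar>\<xi>\<bar> / 2"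
  have x: "0 \<le> x" "x \<le> pi / 2" using assms by (simp_all add: x_def)
  have "x / 2 \<le> sin x"
  proof (cases "x \<le> pi / 3")
    case True
    have "sin 0 - 0 / 2 \<le> sin x - x / 2"
    proof (rule DERIV_nonneg_imp_nondecreasing[OF x(1)])
      fix y assume y: "0 \<le> y" "y \<le> x"
      have "cos (pi / 3) \<le> cos y" using y True by (intro cos_monotone_0_pi_le) auto
      then have "cos y - 1 / 2 \<ge> 0" by (simp add: cos_60)
      moreover have "((\<lambda>x. sin x - x / 2) has_real_derivative cos y - 1 / 2) (at y)"
        by (auto intro!: derivative_eq_intros)
      ultimately show "\<exists>d. ((\<lambda>x. sin x - x / 2) has_real_derivative d) (at y) \<and> 0 \<le> d" by blast
    qed
    then show ?thesis by simp
  next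
    case False
    then have "sin (pi / 3) \<le> sin x" using x by (intro sin_monotone_2pi_le) auto
    moreover have "1.7 \<le> sqrt 3" by (rule real_le_rsqrt) (simp add: power2_eq_square)
    moreover have "x / 2 \<le> 0.85" using x pi_less_4 pi_approx by simp
    ultimately show ?thesis by (simp add: sin_60)
  qed
  moreover have "norm (1 - exp (\<i> * of_real \<xi>)) = 2 * sin x"
  proof -
    have "norm (1 - exp (\<i> * of_real \<xi>)) = 2 * \<bar>sin (\<xi> / 2)\<bar>"
      using dist_exp_i_1[of \<xi>] by (simp add: norm_minus_commute)
    also have "\<bar>sin (\<xi> / 2)\<bar> = \<bar>sin x\<bar>" by (auto simp: x_def abs_if)
    also have "\<bar>sin x\<bar> = sin x" using x by (intro abs_of_nonneg sin_ge_zero) auto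
    finally show ?thesis .
  qed
  ultimately show ?thesis by (simp add: x_def)
qed

section \<open>Pointwise limits under the scaling by \<open>T\<close>\<close>

lemma exp_i_difference_quotient:
  fixes T :: "nat \<Rightarrow> real"
  assumes "filterlim T at_top sequentially"
  shows "(\<lambda>n. of_real (T n) * (1 - exp (\<i> * of_real (u / T n)))) \<longlonglongrightarrow> - \<i> * of_real u"
proof -
  have "((\<lambda>z. exp (\<i> * of_real u * z)) has_field_derivative \<i> * of_real u) (at 0)"
    by (auto intro!: derivative_eq_intros)
  then have "((\<lambda>z. (exp (\<i> * of_real u * z) - 1) / z) \<longlongrightarrow> \<i> * of_real u) (at 0)"
    by (simp add: DERIV_def)
  moreover have "filterlim (\<lambda>n. of_real (inverse (T n)) :: complex) (at 0) sequentially"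
  proof (rule filterlim_atI)
    have "(\<lambda>n. inverse (T n)) \<longlonglongrightarrow> 0"
      by (rule tendsto_inverse_0_at_top[OF assms])
    from tendsto_of_real[OF this, where ?'a = complex]
    show "(\<lambda>n. of_real (inverse (T n)) :: complex) \<longlonglongrightarrow> 0" by simp
    show "\<forall>\<^sub>F n in sequentially. of_real (inverse (T n)) \<noteq> (0::complex)"
      using filterlim_at_top_dense[THEN iffD1, OF assms, rule_format, of 0]
      by eventually_elim simp
  qed
  ultimately have "(\<lambda>n. (exp (\<i> * of_real u * of_real (inverse (T n))) - 1) / of_real (inverse (T n))) \<longlonglongrightarrow> \<i> * of_real u"
    by (rule filterlim_compose)
  from tendsto_minus[OF this] show ?thesis
    by (simp add: divide_inverse algebra_simps)
qed

lemma filterlim_divide_at_0: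
  fixes T :: "nat \<Rightarrow> real"
  assumes "filterlim T at_top sequentially" "\<And>n. T n > 0" "u \<noteq> 0"
  shows "filterlim (\<lambda>n. u / T n) (at 0) sequentially"
proof (rule filterlim_atI)
  show "(\<lambda>n. u / T n) \<longlonglongrightarrow> 0"
    using tendsto_mult[OF tendsto_const[of u] tendsto_inverse_0_at_top[OF assms(1)]] by (simp add: divide_inverse)
  show "\<forall>\<^sub>F n in sequentially. u / T n \<noteq> 0"
    using assms(2,3) by (intro always_eventually allI) (simp add: less_imp_neq[symmetric])
qed

text \<open>As \<open>T^2 = \<sigma>^2 * lam\<close>, the quadratic term becomes exactly
  \<open>- u^2 / 2\<close>, the linear term is subtracted, and the remainder is
  \<open>u^2 / \<sigma>^2\<close> times a quantity tending to zero.\<close>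

lemma exponent_scaling_limit:
  fixes \<phi> :: "real \<Rightarrow> complex" and lam T :: "nat \<Rightarrow> real"
  assumes o: "(\<lambda>\<xi>. \<phi> \<xi> - (\<i> * of_real (m * \<xi>) - of_real (\<sigma>\<^sup>2 * \<xi>\<^sup>2 / 2))) \<in> o[at 0](\<lambda>\<xi>. of_real (\<xi>\<^sup>2))"
    and T: "filterlim T at_top sequentially" "\<And>n. T n > 0" "\<And>n. (T n)\<^sup>2 = \<sigma>\<^sup>2 * lam n"
    and \<sigma>: "\<sigma> \<noteq> 0" and u: "u \<noteq> 0"
  shows "(\<lambda>n. of_real (lam n) * \<phi> (u / T n) - \<i> * of_real (lam n * m * u / T n)) \<longlonglongrightarrow> of_real (- u\<^sup>2 / 2)"
proof -
  define R where "R \<xi> = \<phi> \<xi> - (\<i> * of_real (m * \<xi>) - of_real (\<sigma>\<^sup>2 * \<xi>\<^sup>2 / 2))" for \<xi>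
  have "((\<lambda>\<xi>. R \<xi> / of_real (\<xi>\<^sup>2)) \<longlongrightarrow> 0) (at 0)"
    using smalloD_tendsto[OF o] unfolding R_def .
  moreover have "filterlim (\<lambda>n. u / T n) (at 0) sequentially"
    by (rule filterlim_divide_at_0[OF T(1,2) u])
  ultimately have "(\<lambda>n. R (u / T n) / of_real ((u / T n)\<^sup>2)) \<longlonglongrightarrow> 0"
    by (rule filterlim_compose)
  from tendsto_add[OF tendsto_mult[OF tendsto_const[of "of_real (u\<^sup>2 / \<sigma>\<^sup>2)"] this] tendsto_const[of "of_real (- u\<^sup>2 / 2)"]]
  have "(\<lambda>n. of_real (u\<^sup>2 / \<sigma>\<^sup>2) * (R (u / T n) / of_real ((u / T n)\<^sup>2)) + of_real (- u\<^sup>2 / 2)) \<longlonglongrightarrow> of_real (- u\<^sup>2 / 2)"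
    by (simp del: of_real_power of_real_divide of_real_minus)
  moreover have "of_real (u\<^sup>2 / \<sigma>\<^sup>2) * (R (u / T n) / of_real ((u / T n)\<^sup>2)) + of_real (- u\<^sup>2 / 2) =
      of_real (lam n) * \<phi> (u / T n) - \<i> * of_real (lam n * m * u / T n)" for n
  proof -
    have lam: "u\<^sup>2 / \<sigma>\<^sup>2 / (u / T n)\<^sup>2 = lam n"
      using T(2)[of n] u \<sigma> by (simp add: power_divide T(3))
    have quad: "lam n * (\<sigma>\<^sup>2 * (u / T n)\<^sup>2 / 2) = u\<^sup>2 / 2"
    proof -
      have "lam n = (T n)\<^sup>2 / \<sigma>\<^sup>2" using T(3)[of n] \<sigma> by simp
      then show ?thesis using T(2)[of n] \<sigma> by (simp add: power_divide)
    qed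
    have "of_real (u\<^sup>2 / \<sigma>\<^sup>2) * (R (u / T n) / of_real ((u / T n)\<^sup>2)) = of_real (u\<^sup>2 / \<sigma>\<^sup>2 / (u / T n)\<^sup>2) * R (u / T n)"
      by simp
    also have "\<dots> = of_real (lam n) * R (u / T n)" by (simp only: lam)
    also have "\<dots> = of_real (lam n) * \<phi> (u / T n) - \<i> * of_real (lam n * m * u / T n) + of_real (lam n * (\<sigma>\<^sup>2 * (u / T n)\<^sup>2 / 2))"
      by (simp add: R_def algebra_simps)
    finally show ?thesis unfolding quad by simp
  qed
  ultimately show ?thesis by simp
qed

text \<open>The error \<open>e n\<close> is the L1 distance between the rescaled integrand and its
  Gaussian limit. The index \<open>k\<close> enters only through a phase of modulus one, which makes
  the bound uniform in \<open>k\<close>.\<close>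

lemma local_limit_dominated:
  fixes \<phi> :: "real \<Rightarrow> complex" and lam T :: "nat \<Rightarrow> real" and h :: "nat \<Rightarrow> real \<Rightarrow> complex"
  assumes cont: "continuous_on UNIV \<phi>"
    and c: "c > 0" "\<And>\<xi>. \<bar>\<xi>\<bar> \<le> pi \<Longrightarrow> Re (\<phi> \<xi>) \<le> - c * \<xi>\<^sup>2"
    and o: "(\<lambda>\<xi>. \<phi> \<xi> - (\<i> * of_real (m * \<xi>) - of_real (\<sigma>\<^sup>2 * \<xi>\<^sup>2 / 2))) \<in> o[at 0](\<lambda>\<xi>. of_real (\<xi>\<^sup>2))"
    and T: "filterlim T at_top sequentially" "\<And>n. T n > 0" "\<And>n. (T n)\<^sup>2 = \<sigma>\<^sup>2 * lam n"
    and \<sigma>: "\<sigma> \<noteq> 0"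
    and meas: "\<And>n. h n \<in> borel_measurable borel"
    and bound: "\<And>n \<xi>. \<bar>\<xi>\<bar> \<le> pi \<Longrightarrow> norm (h n \<xi>) \<le> C * \<bar>\<xi>\<bar> ^ r"
    and lim: "\<And>u. u \<noteq> 0 \<Longrightarrow> (\<lambda>n. of_real (T n ^ r) * h n (u / T n)) \<longlonglongrightarrow> b * (\<i> * of_real u) ^ r"
  obtains e :: "nat \<Rightarrow> real" where "e \<longlonglongrightarrow> 0"
    and "\<And>n k. norm (of_real (T n ^ Suc r) * (LINT \<xi>:{-pi..pi}|lborel. exp (of_real (lam n) * \<phi> \<xi>) * h n \<xi> * exp (- \<i> * of_real k * of_real \<xi>))
        - b * of_real (sqrt (2 * pi) * hermite_fun r ((m * lam n - k) / T n))) \<le> e n"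
proof -
  \<comment> \<open>The integrand after \<open>\<xi> = u / T n\<close>, with the drift phase
    removed. Drift and character \<open>exp (- \<i> * k * \<xi>)\<close> combine to
    \<open>exp (\<i> * u * x)\<close> with \<open>x = (m * lam n - k) / T n\<close>.\<close>
  define A where "A n u = indicator {-pi..pi} (u / T n) *\<^sub>R
    (exp (of_real (lam n) * \<phi> (u / T n) - \<i> * of_real (lam n * m * u / T n)) * (of_real (T n ^ r) * h n (u / T n)))" for n u
  define G where "G u = exp (of_real (- u\<^sup>2 / 2)) * (b * (\<i> * of_real u) ^ r)" for u :: real
  define w where "w u = C * (exp (- (c / \<sigma>\<^sup>2) * u\<^sup>2) * \<bar>u\<bar> ^ r)" for u :: real
  have [measurable]: "\<phi> \<in> borel_measurable borel"
    using cont by (rule borel_measurable_continuous_onI)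
  note meas [measurable]
  have A_meas [measurable]: "A n \<in> borel_measurable borel" for n unfolding A_def by measurable
  have G_meas [measurable]: "G \<in> borel_measurable borel" unfolding G_def by measurable
  have A_le: "norm (A n u) \<le> w u" for n u
  proof (cases "u / T n \<in> {-pi..pi}")
    case False
    \<comment> \<open>The bound at the point \<open>1\<close>, which lies in
      \<open>[-pi, pi]\<close>, shows \<open>C \<ge> 0\<close>.\<close>
    have "norm (h 0 1) \<le> C * \<bar>1\<bar> ^ r" using bound[of 1 0] pi_gt3 by simp
    then have "0 \<le> C" by (simp add: order_trans[OF norm_ge_zero])
    then show ?thesis using False by (simp add: A_def w_def)
  next
    case True
    define \<xi> where "\<xi> = u / T n"
    have \<xi>: "\<bar>\<xi>\<bar> \<le> pi" using True by (auto simp: \<xi>_def abs_le_iff)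
    have lam: "lam n \<ge> 0"
      using T(3)[of n] \<sigma> by (metis zero_le_power2 zero_less_power2 zero_le_mult_iff not_less)
    have "norm (A n u) = exp (lam n * Re (\<phi> \<xi>)) * (T n ^ r * norm (h n \<xi>))"
      using True T(2)[of n] by (simp add: A_def \<xi>_def norm_mult norm_power)
    also have "\<dots> \<le> exp (lam n * (- c * \<xi>\<^sup>2)) * (T n ^ r * (C * \<bar>\<xi>\<bar> ^ r))"
      using T(2)[of n] mult_left_mono[OF c(2)[OF \<xi>] lam] bound[OF \<xi>, of n]
      by (intro mult_mono) auto
    \<comment> \<open>The identity \<open>lam n / (T n)^2 = 1 / \<sigma>^2\<close> removes the
      dependence on \<open>n\<close>, leaving a fixed integrable majorant.\<close>
    also have "lam n * (- c * \<xi>\<^sup>2) = - (c / \<sigma>\<^sup>2) * u\<^sup>2"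
    proof -
      have "lam n = (T n)\<^sup>2 / \<sigma>\<^sup>2" using T(3)[of n] \<sigma> by simp
      then show ?thesis using T(2)[of n] by (simp add: \<xi>_def power_divide)
    qed
    also have "T n ^ r * (C * \<bar>\<xi>\<bar> ^ r) = C * \<bar>u\<bar> ^ r"
      using T(2)[of n] by (simp add: \<xi>_def abs_divide power_divide)
    finally show ?thesis by (simp add: w_def mult_ac)
  qed
  have w_int: "integrable lborel w"
    unfolding w_def by (intro integrable_mult_right integrable_gaussian_moment divide_pos_pos c) (use \<sigma> in simp)
  have A_int: "integrable lborel (A n)" for n
    by (rule Bochner_Integration.integrable_bound[OF w_int]) (use A_le in \<open>auto intro!: AE_I2 order_trans[OF A_le abs_ge_self]\<close>)
  have G_wave: "G u * exp (\<i> * of_real (u * x)) = b * gauss_wave r x u" for u x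
    by (simp only: G_def gauss_wave_def exp_add mult_ac)
  have G_int: "integrable lborel G"
  proof -
    have "G = (\<lambda>u. b * gauss_wave r 0 u)" using G_wave[of _ 0] by (simp add: fun_eq_iff)
    then show ?thesis using integrable_mult_right[OF integrable_gauss_wave[of r 0], of b] by simp
  qed
  \<comment> \<open>The origin, where the limit of \<open>h\<close> is unspecified, is a null set;
    for every other \<open>u\<close> the cutoff is eventually inactive.\<close>
  have A_lim: "(\<lambda>n. A n u) \<longlonglongrightarrow> G u" if "u \<noteq> 0" for u
  proof -
    have "(\<lambda>n. exp (of_real (lam n) * \<phi> (u / T n) - \<i> * of_real (lam n * m * u / T n)) * (of_real (T n ^ r) * h n (u / T n))) \<longlonglongrightarrow> G u"
      unfolding G_def by (intro tendsto_mult tendsto_exp exponent_scaling_limit[OF o T \<sigma> that] lim that)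
    moreover have "\<forall>\<^sub>F n in sequentially. exp (of_real (lam n) * \<phi> (u / T n) - \<i> * of_real (lam n * m * u / T n)) * (of_real (T n ^ r) * h n (u / T n)) = A n u"
      using filterlim_at_top[THEN iffD1, OF T(1), rule_format, of "\<bar>u\<bar> / pi"]
    proof eventually_elim
      case (elim n)
      then have "\<bar>u\<bar> \<le> pi * T n" by (simp add: field_simps)
      then have "u / T n \<in> {-pi..pi}" using T(2)[of n] by (auto simp: field_simps abs_le_iff)
      then show ?case by (simp add: A_def)
    qed
    ultimately show ?thesis by (rule Lim_transform_eventually)
  qed
  define e where "e n = (\<integral>u. norm (A n u - G u) \<partial>lborel)" for n
  show thesis
  proof (rule that[of e])
    have "e \<longlonglongrightarrow> (\<integral>u. 0 \<partial>(lborel :: real measure))"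
      unfolding e_def
    proof (rule integral_dominated_convergence[where w = "\<lambda>u. w u + norm (G u)"])
      show "integrable lborel (\<lambda>u. w u + norm (G u))" using w_int G_int by simp
      show "AE u in lborel. (\<lambda>n. norm (A n u - G u)) \<longlonglongrightarrow> 0"
        using AE_lborel_singleton[of 0]
      proof eventually_elim
        case (elim u)
        from tendsto_norm[OF tendsto_diff[OF A_lim[OF elim] tendsto_const[of "G u"]]]
        show ?case by simp
      qed
      show "AE u in lborel. norm (norm (A n u - G u)) \<le> w u + norm (G u)" for n
        using A_le[of n] by (intro AE_I2) (simp add: order_trans[OF norm_triangle_ineq4])
    qed auto
    then show "e \<longlonglongrightarrow> 0" by simp
  next
    fix n and k :: real
    define x where "x = (m * lam n - k) / T n"
    have subst: "(LINT \<xi>:{-pi..pi}|lborel. exp (of_real (lam n) * \<phi> \<xi>) * h n \<xi> * exp (- \<i> * of_real k * of_real \<xi>)) =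
      \<bar>1 / T n\<bar> *\<^sub>R (\<integral>u. indicator {-pi..pi} (0 + 1 / T n * u) *\<^sub>R (exp (of_real (lam n) * \<phi> (0 + 1 / T n * u)) * h n (0 + 1 / T n * u) *
        exp (- \<i> * of_real k * of_real (0 + 1 / T n * u))) \<partial>lborel)"
      unfolding set_lebesgue_integral_def
      by (rule lborel_integral_real_affine) (use T(2)[of n] in simp)
    have 1: "of_real (T n ^ Suc r) * (LINT \<xi>:{-pi..pi}|lborel. exp (of_real (lam n) * \<phi> \<xi>) * h n \<xi> * exp (- \<i> * of_real k * of_real \<xi>)) =
      (\<integral>u. A n u * exp (\<i> * of_real (u * x)) \<partial>lborel)"
    proof -
      have "of_real (T n ^ Suc r) * (\<bar>1 / T n\<bar> *\<^sub>R z) = of_real (T n ^ r) * z" for z :: complex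
        using T(2)[of n] by (simp add: scaleR_conv_of_real)
      moreover have "of_real (T n ^ r) * (indicator {-pi..pi} (0 + 1 / T n * u) *\<^sub>R (exp (of_real (lam n) * \<phi> (0 + 1 / T n * u)) * h n (0 + 1 / T n * u) *
        exp (- \<i> * of_real k * of_real (0 + 1 / T n * u)))) = A n u * exp (\<i> * of_real (u * x))" for u
      proof -
        have "exp (of_real (lam n) * \<phi> (u / T n)) * exp (- \<i> * of_real k * of_real (u / T n)) =
          exp (of_real (lam n) * \<phi> (u / T n) - \<i> * of_real (lam n * m * u / T n)) * exp (\<i> * of_real (u * x))"
        proof -
          have "u * x = lam n * m * u / T n - k * (u / T n)"
            by (simp add: x_def diff_divide_distrib algebra_simps)
          then have ux: "of_real (u * x) = (of_real (lam n * m * u / T n) - of_real k * of_real (u / T n) :: complex)"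
            by (simp only: of_real_diff of_real_mult)
          have "of_real (lam n) * \<phi> (u / T n) + - \<i> * of_real k * of_real (u / T n) =
            of_real (lam n) * \<phi> (u / T n) - \<i> * of_real (lam n * m * u / T n) + \<i> * of_real (u * x)"
            unfolding ux by (simp add: algebra_simps del: of_real_mult of_real_divide)
          then show ?thesis by (simp only: exp_add[symmetric])
        qed
        then show ?thesis by (simp add: A_def mult_ac)
      qed
      ultimately show ?thesis
        unfolding subst by (simp only: integral_mult_right_zero[symmetric])
    qed
    have 2: "b * of_real (sqrt (2 * pi) * hermite_fun r x) = (\<integral>u. G u * exp (\<i> * of_real (u * x)) \<partial>lborel)"
      unfolding G_wave by (simp add: integral_gauss_wave)
    have int_exp: "integrable lborel (\<lambda>u. f u * exp (\<i> * of_real (u * x)))" if "integrable lborel f" for f :: "real \<Rightarrow> complex"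
    proof (rule Bochner_Integration.integrable_bound[OF that])
      have [measurable]: "f \<in> borel_measurable lborel" using that by (rule borel_measurable_integrable)
      show "(\<lambda>u. f u * exp (\<i> * of_real (u * x))) \<in> borel_measurable lborel" by measurable
      show "AE u in lborel. norm (f u * exp (\<i> * of_real (u * x))) \<le> norm (f u)" by (intro AE_I2) (simp add: norm_mult)
    qed
    have "(\<integral>u. A n u * exp (\<i> * of_real (u * x)) \<partial>lborel) - (\<integral>u. G u * exp (\<i> * of_real (u * x)) \<partial>lborel) =
      (\<integral>u. (A n u - G u) * exp (\<i> * of_real (u * x)) \<partial>lborel)"
      using int_exp[OF A_int[of n]] int_exp[OF G_int]
      by (simp only: left_diff_distrib Bochner_Integration.integral_diff)
    also have "norm \<dots> \<le> (\<integral>u. norm ((A n u - G u) * exp (\<i> * of_real (u * x))) \<partial>lborel)"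
      by (rule integral_norm_bound)
    also have "\<dots> = e n" by (simp add: e_def norm_mult)
    finally show "norm (of_real (T n ^ Suc r) * (LINT \<xi>:{-pi..pi}|lborel. exp (of_real (lam n) * \<phi> \<xi>) * h n \<xi> * exp (- \<i> * of_real k * of_real \<xi>))
        - b * of_real (sqrt (2 * pi) * hermite_fun r ((m * lam n - k) / T n))) \<le> e n"
      unfolding 1 x_def[symmetric] 2 .
  qed
qed

text \<open>Dividing by \<open>1 - exp (\<i> * \<xi>)\<close>, which behaves like
  \<open>- \<i> * \<xi>\<close>, lowers the power to \<open>r\<close> and flips the sign; the local
  limit then applies to the cumulative masses, and letting \<open>k\<close> tend to minus infinity
  controls the additive constant.\<close>

lemma cumulative_approximation:
  fixes \<phi> :: "real \<Rightarrow> complex" and lam T :: "nat \<Rightarrow> real" and w :: "nat \<Rightarrow> real \<Rightarrow> complex"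
    and \<Delta> :: "nat \<Rightarrow> int set \<Rightarrow> real"
  assumes cont: "continuous_on UNIV \<phi>"
    and c: "c > 0" "\<And>\<xi>. \<bar>\<xi>\<bar> \<le> pi \<Longrightarrow> Re (\<phi> \<xi>) \<le> - c * \<xi>\<^sup>2"
    and o: "(\<lambda>\<xi>. \<phi> \<xi> - (\<i> * of_real (m * \<xi>) - of_real (\<sigma>\<^sup>2 * \<xi>\<^sup>2 / 2))) \<in> o[at 0](\<lambda>\<xi>. of_real (\<xi>\<^sup>2))"
    and T: "filterlim T at_top sequentially" "\<And>n. T n > 0" "\<And>n. (T n)\<^sup>2 = \<sigma>\<^sup>2 * lam n"
    and \<sigma>: "\<sigma> \<noteq> 0"
    and \<Delta>: "\<And>n. finite_signed_measure (\<Delta> n)" "\<And>n. \<Delta> n UNIV = 0"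
      "\<And>n \<xi>. fourier_Z (\<Delta> n) \<xi> = exp (of_real (lam n) * \<phi> \<xi>) * w n \<xi>"
    and bound: "\<And>n \<xi>. \<bar>\<xi>\<bar> \<le> pi \<Longrightarrow> norm (w n \<xi>) \<le> C * \<bar>\<xi>\<bar> ^ Suc r"
    and lim: "\<And>u. u \<noteq> 0 \<Longrightarrow> (\<lambda>n. of_real (T n ^ Suc r) * w n (u / T n)) \<longlonglongrightarrow> b * (\<i> * of_real u) ^ Suc r"
  obtains e :: "nat \<Rightarrow> real" where "e \<longlonglongrightarrow> 0"
    and "\<And>n k. norm (of_real (T n ^ Suc r * \<Delta> n {j. j \<le> k})
        + b * of_real (hermite_fun r ((m * lam n - of_int k) / T n) / sqrt (2 * pi))) \<le> e n"
proof -
  define h where "h n \<xi> = w n \<xi> / (1 - exp (\<i> * of_real \<xi>))" for n and \<xi> :: real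
  have [measurable]: "\<phi> \<in> borel_measurable borel"
    using cont by (rule borel_measurable_continuous_onI)
  have [measurable]: "fourier_Z (\<Delta> n) \<in> borel_measurable borel" for n
    by (rule borel_measurable_fourier_Z[OF \<Delta>(1)])
  \<comment> \<open>Measurability is inherited from the transform: \<open>w n\<close> is recovered
    by dividing by the exponential, which never vanishes.\<close>
  have "h n = (\<lambda>\<xi>. fourier_Z (\<Delta> n) \<xi> / exp (of_real (lam n) * \<phi> \<xi>) / (1 - exp (\<i> * of_real \<xi>)))" for n
    by (simp add: h_def[abs_def] \<Delta>(3))
  then have h_meas [measurable]: "h n \<in> borel_measurable borel" for n by simp
  have "norm (w 0 1) \<le> C * \<bar>1\<bar> ^ Suc r" using bound[of 1 0] pi_gt3 by simp
  then have C: "0 \<le> C" by (simp add: order_trans[OF norm_ge_zero])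
  \<comment> \<open>The doubled constant comes from the lower bound
    \<open>\<bar>\<xi>\<bar> / 2\<close> for the denominator; at \<open>0\<close> the quotient is
    \<open>0\<close> by the convention for division by zero.\<close>
  have h_bound: "norm (h n \<xi>) \<le> (2 * C) * \<bar>\<xi>\<bar> ^ r" if "\<bar>\<xi>\<bar> \<le> pi" for n \<xi>
  proof (cases "\<xi> = 0")
    case True
    then show ?thesis using C by (simp add: h_def)
  next
    case False
    have "norm (h n \<xi>) = norm (w n \<xi>) / norm (1 - exp (\<i> * of_real \<xi>))" by (simp add: h_def norm_divide)
    also have "\<dots> \<le> (C * \<bar>\<xi>\<bar> ^ Suc r) / (\<bar>\<xi>\<bar> / 2)"
      using bound[OF that] norm_1_minus_exp_i_lower[OF that] False C by (intro frac_le) auto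
    also have "\<dots> = (2 * C) * \<bar>\<xi>\<bar> ^ r" using False by simp
    finally show ?thesis .
  qed
  have h_lim: "(\<lambda>n. of_real (T n ^ r) * h n (u / T n)) \<longlonglongrightarrow> - b * (\<i> * of_real u) ^ r" if "u \<noteq> 0" for u
  proof -
    have "(\<lambda>n. of_real (T n ^ Suc r) * w n (u / T n) / (of_real (T n) * (1 - exp (\<i> * of_real (u / T n))))) \<longlonglongrightarrow>
      b * (\<i> * of_real u) ^ Suc r / (- \<i> * of_real u)"
      by (intro tendsto_divide lim[OF that] exp_i_difference_quotient[OF T(1)]) (use that in simp)
    moreover have "b * (\<i> * of_real u) ^ Suc r / (- \<i> * of_real u) = - b * (\<i> * of_real u) ^ r"
      using that by (simp add: divide_simps)
    moreover have "of_real (T n ^ Suc r) * w n (u / T n) / (of_real (T n) * (1 - exp (\<i> * of_real (u / T n)))) =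
      of_real (T n ^ r) * h n (u / T n)" for n
      using T(2)[of n] by (simp add: h_def)
    ultimately show ?thesis by (simp only:)
  qed
  define f where "f n k = (LINT \<xi>:{-pi..pi}|lborel. exp (of_real (lam n) * \<phi> \<xi>) * h n \<xi> * exp (- \<i> * of_real k * of_real \<xi>))" for n and k :: real
  define B where "B n k = b * of_real (sqrt (2 * pi) * hermite_fun r ((m * lam n - k) / T n))" for n and k :: real
  obtain e0 where e0: "e0 \<longlonglongrightarrow> 0"
    and e0_le: "\<And>n k. norm (of_real (T n ^ Suc r) * f n k + B n k) \<le> e0 n"
  proof (rule local_limit_dominated[OF cont c o T \<sigma> h_meas h_bound h_lim])
    fix e0 :: "nat \<Rightarrow> real"
    assume e0: "e0 \<longlonglongrightarrow> 0" and le: "\<And>n k. norm (of_real (T n ^ Suc r) * (LINT \<xi>:{-pi..pi}|lborel. exp (of_real (lam n) * \<phi> \<xi>) * h n \<xi> * exp (- \<i> * of_real k * of_real \<xi>))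
        - - b * of_real (sqrt (2 * pi) * hermite_fun r ((m * lam n - k) / T n))) \<le> e0 n"
    have "norm (of_real (T n ^ Suc r) * f n k + B n k) \<le> e0 n" for n k
      using le[of n k] unfolding f_def[symmetric] by (simp only: B_def minus_mult_left[symmetric] diff_minus_eq_add)
    with e0 show thesis by (rule that)
  qed
  \<comment> \<open>One \<open>e0 n\<close> comes from the local limit, the other from the additive
    constant.\<close>
  have main: "norm (of_real (T n ^ Suc r) * of_real (2 * pi * \<Delta> n {j. j \<le> k}) + B n (of_int k)) \<le> 2 * e0 n" for n k
  proof -
    have lam: "lam n \<ge> 0"
      using T(3)[of n] \<sigma> by (metis zero_le_power2 zero_less_power2 zero_le_mult_iff not_less)
    have "set_integrable lborel {-pi..pi} (\<lambda>\<xi>. fourier_Z (\<Delta> n) \<xi> / (1 - exp (\<i> * of_real \<xi>)))"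
      unfolding set_integrable_def
    proof (rule Bochner_Integration.integrable_bound)
      show "integrable lborel (\<lambda>\<xi>. indicator {-pi..pi} \<xi> *\<^sub>R (2 * C * pi ^ r))"
        by (rule borel_integrable_compact) auto
      show "AE \<xi> in lborel. norm (indicator {-pi..pi} \<xi> *\<^sub>R (fourier_Z (\<Delta> n) \<xi> / (1 - exp (\<i> * of_real \<xi>)))) \<le>
          norm (indicator {-pi..pi} \<xi> *\<^sub>R (2 * C * pi ^ r))"
      proof (rule AE_I2)
        fix \<xi> :: real
        show "norm (indicator {-pi..pi} \<xi> *\<^sub>R (fourier_Z (\<Delta> n) \<xi> / (1 - exp (\<i> * of_real \<xi>)))) \<le>
          norm (indicator {-pi..pi} \<xi> *\<^sub>R (2 * C * pi ^ r))"
        proof (cases "\<xi> \<in> {-pi..pi}")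
          case True
          then have \<xi>: "\<bar>\<xi>\<bar> \<le> pi" by (auto simp: abs_le_iff)
          have "0 \<le> c * \<xi>\<^sup>2" using c(1) by simp
          then have "Re (\<phi> \<xi>) \<le> 0" using c(2)[OF \<xi>] by linarith
          then have "norm (exp (of_real (lam n) * \<phi> \<xi>)) \<le> 1" using lam by (simp add: mult_nonneg_nonpos)
          moreover have "norm (h n \<xi>) \<le> 2 * C * pi ^ r"
            using h_bound[OF \<xi>, of n] C \<xi> by (elim order_trans) (intro mult_left_mono power_mono; simp)
          ultimately have "norm (exp (of_real (lam n) * \<phi> \<xi>)) * norm (h n \<xi>) \<le> 1 * (2 * C * pi ^ r)"
            by (intro mult_mono) auto
          then show ?thesis using True C by (simp add: \<Delta>(3) h_def norm_mult norm_divide)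
        qed simp
      qed
    qed measurable
    from cumulative_fourier_inversion[OF \<Delta>(1,2) this] obtain g where g:
      "\<And>k. of_real (2 * pi * \<Delta> n {j. j \<le> k}) = f n (of_int k) + g"
      by (auto simp: f_def \<Delta>(3) h_def)
    \<comment> \<open>both the distribution function and the Hermite term vanish as \<open>k\<close> tends to \<open>-\<infinity>\<close>, so the
      additive constant is no larger than the approximation error\<close>
    have "norm (of_real (T n ^ Suc r) * g) \<le> e0 n"
    proof (rule LIMSEQ_le_const)
      let ?a = "\<lambda>N::nat. e0 n + norm (of_real (T n ^ Suc r) * of_real (2 * pi * \<Delta> n {j. j \<le> - int N}) + B n (of_int (- int N)))"
      have "(\<lambda>N. B n (of_int (- int N))) \<longlonglongrightarrow> b * of_real (sqrt (2 * pi) * 0)"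
        unfolding B_def
      proof (intro tendsto_mult tendsto_const tendsto_of_real filterlim_compose[OF hermite_fun_tendsto_0_at_top])
        have "filterlim (\<lambda>N. m * lam n / T n + 1 / T n * real N) at_top sequentially"
          using T(2)[of n]
          by (intro filterlim_tendsto_add_at_top[OF tendsto_const] filterlim_tendsto_pos_mult_at_top[OF tendsto_const]
              filterlim_real_sequentially) auto
        then show "filterlim (\<lambda>N. (m * lam n - of_int (- int N)) / T n) at_top sequentially"
          by (simp add: add_divide_distrib)
      qed
      moreover have "(\<lambda>N. of_real (T n ^ Suc r) * of_real (2 * pi * \<Delta> n {j. j \<le> - int N})) \<longlonglongrightarrow>
          (of_real (T n ^ Suc r) * of_real (2 * pi * 0) :: complex)"
        by (intro tendsto_mult tendsto_const tendsto_of_real finite_signed_measure_atMost_tendsto_0 \<Delta>)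
      ultimately have "?a \<longlonglongrightarrow> e0 n + norm (of_real (T n ^ Suc r) * of_real (2 * pi * 0) + b * of_real (sqrt (2 * pi) * 0))"
        by (intro tendsto_add tendsto_const tendsto_norm)
      then show "?a \<longlonglongrightarrow> e0 n" by simp
      have "norm (of_real (T n ^ Suc r) * g) \<le> ?a N" for N
      proof -
        have "of_real (T n ^ Suc r) * g = of_real (T n ^ Suc r) * of_real (2 * pi * \<Delta> n {j. j \<le> - int N}) + B n (of_int (- int N))
          - (of_real (T n ^ Suc r) * f n (of_int (- int N)) + B n (of_int (- int N)))"
          unfolding g by (simp add: algebra_simps)
        also have "norm \<dots> \<le> norm (of_real (T n ^ Suc r) * of_real (2 * pi * \<Delta> n {j. j \<le> - int N}) + B n (of_int (- int N)))
          + norm (of_real (T n ^ Suc r) * f n (of_int (- int N)) + B n (of_int (- int N)))"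
          by (rule norm_triangle_ineq4)
        finally show ?thesis using e0_le[of n "of_int (- int N)"] by linarith
      qed
      then show "\<exists>N0. \<forall>N\<ge>N0. norm (of_real (T n ^ Suc r) * g) \<le> ?a N" by blast
    qed
    moreover have "of_real (T n ^ Suc r) * of_real (2 * pi * \<Delta> n {j. j \<le> k}) + B n (of_int k) =
        (of_real (T n ^ Suc r) * f n (of_int k) + B n (of_int k)) + of_real (T n ^ Suc r) * g"
      unfolding g by (simp add: algebra_simps)
    ultimately show ?thesis
      using e0_le[of n "of_int k"] norm_triangle_ineq[of "of_real (T n ^ Suc r) * f n (of_int k) + B n (of_int k)" "of_real (T n ^ Suc r) * g"]
      by (simp only:)
  qed
  show thesis
  proof (rule that[of "\<lambda>n. e0 n / pi"])
    show "(\<lambda>n. e0 n / pi) \<longlonglongrightarrow> 0" using tendsto_divide[OF e0 tendsto_const[of pi]] by simp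
    fix n k
    let ?G = "hermite_fun r ((m * lam n - of_int k) / T n)"
    \<comment> \<open>Inversion carries a factor \<open>2 * pi\<close>, and
      \<open>sqrt (2 * pi) / (2 * pi) = 1 / sqrt (2 * pi)\<close>; the error becomes
      \<open>2 * e0 n / (2 * pi)\<close>.\<close>
    have s: "?G / sqrt (2 * pi) = sqrt (2 * pi) * ?G / (2 * pi)"
    proof -
      have q: "0 \<le> 2 * pi" "sqrt (2 * pi) \<noteq> 0" by simp_all
      have "sqrt (2 * pi) * ?G / (2 * pi) = sqrt (2 * pi) * ?G / (sqrt (2 * pi) * sqrt (2 * pi))"
        by (simp only: real_sqrt_mult_self abs_of_nonneg[OF q(1)])
      also have "\<dots> = ?G / sqrt (2 * pi)" by (rule nonzero_mult_divide_mult_cancel_left[OF q(2)])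
      finally show ?thesis ..
    qed
    have "of_real (T n ^ Suc r * \<Delta> n {j. j \<le> k}) + b * of_real (?G / sqrt (2 * pi)) =
      (of_real (T n ^ Suc r) * of_real (2 * pi * \<Delta> n {j. j \<le> k}) + B n (of_int k)) / of_real (2 * pi)"
      unfolding B_def s by (simp add: add_divide_distrib)
    also have "norm \<dots> \<le> 2 * e0 n / (2 * pi)"
    proof -
      have "norm (of_real (2 * pi) :: complex) = 2 * pi" by simp
      then show ?thesis unfolding norm_divide by (simp only:) (intro divide_right_mono main, simp)
    qed
    finally show "norm (of_real (T n ^ Suc r * \<Delta> n {j. j \<le> k}) + b * of_real (?G / sqrt (2 * pi))) \<le> e0 n / pi"
      by simp
  qed
qed

text \<open>From above, every grid value is at most the global maximum of the Hermite term up to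
  \<open>e n\<close>; from below, one grid point approaching the maximiser suffices.\<close>

lemma sup_cumulative_limit:
  fixes T lam e :: "nat \<Rightarrow> real" and \<Delta> :: "nat \<Rightarrow> int set \<Rightarrow> real" and b :: complex
  assumes T: "filterlim T at_top sequentially" "\<And>n. T n > 0"
    and e: "e \<longlonglongrightarrow> 0"
    and approx: "\<And>n k. norm (of_real (T n ^ Suc r * \<Delta> n {j. j \<le> k})
        + b * of_real (hermite_fun r ((m * lam n - of_int k) / T n) / sqrt (2 * pi))) \<le> e n"
  shows "(\<lambda>n. T n ^ Suc r * (SUP k. \<bar>\<Delta> n {j. j \<le> k}\<bar>)) \<longlonglongrightarrow>
    norm b * \<bar>hermite_fun r (hermite_z (Suc r))\<bar> / sqrt (2 * pi)"
proof -
  define z where "z = hermite_z (Suc r)"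
  define S where "S x = norm b * \<bar>hermite_fun r x\<bar> / sqrt (2 * pi)" for x
  \<comment> \<open>Rounding down places \<open>x n\<close> between \<open>z\<close> and
    \<open>z + 1 / T n\<close>.\<close>
  define k where "k n = \<lfloor>m * lam n - T n * z\<rfloor>" for n
  define x where "x n = (m * lam n - of_int (k n)) / T n" for n
  have S_le: "S y \<le> S z" for y
    unfolding S_def z_def using abs_hermite_fun_le_at_hermite_z by (intro divide_right_mono mult_left_mono) auto
  have close: "\<bar>T n ^ Suc r * \<bar>\<Delta> n {j. j \<le> l}\<bar> - S ((m * lam n - of_int l) / T n)\<bar> \<le> e n" for n l
  proof -
    let ?G = "hermite_fun r ((m * lam n - of_int l) / T n)"
    have "norm (of_real (T n ^ Suc r * \<Delta> n {j. j \<le> l}) :: complex) = T n ^ Suc r * \<bar>\<Delta> n {j. j \<le> l}\<bar>"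
      unfolding norm_of_real using T(2)[of n] by (simp add: abs_mult)
    moreover have "norm (- (b * of_real (?G / sqrt (2 * pi)))) = S ((m * lam n - of_int l) / T n)"
      unfolding norm_minus_cancel norm_mult norm_of_real by (simp add: S_def abs_divide)
    ultimately show ?thesis
      using norm_triangle_ineq3[of "of_real (T n ^ Suc r * \<Delta> n {j. j \<le> l})" "- (b * of_real (?G / sqrt (2 * pi)))"]
        approx[of n l] by (simp only: diff_minus_eq_add)
  qed
  \<comment> \<open>A bound uniform in \<open>l\<close>; it also makes the family bounded above, so
    that the supremum over the integers is meaningful.\<close>
  have pw: "\<bar>\<Delta> n {j. j \<le> l}\<bar> \<le> (S z + e n) / T n ^ Suc r" for n l
  proof -
    have "\<bar>\<Delta> n {j. j \<le> l}\<bar> * T n ^ Suc r \<le> S z + e n"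
      using close[of n l] S_le[of "(m * lam n - of_int l) / T n"] by (simp add: mult.commute abs_le_iff)
    then show ?thesis using T(2)[of n] by (simp add: pos_le_divide_eq)
  qed
  have bdd: "bdd_above (range (\<lambda>l. \<bar>\<Delta> n {j. j \<le> l}\<bar>))" for n
    using pw[of n] by (intro bdd_aboveI2)
  have upper: "T n ^ Suc r * (SUP l. \<bar>\<Delta> n {j. j \<le> l}\<bar>) \<le> S z + e n" for n
  proof -
    have "(SUP l. \<bar>\<Delta> n {j. j \<le> l}\<bar>) \<le> (S z + e n) / T n ^ Suc r" by (intro cSUP_least pw) simp
    then show ?thesis using T(2)[of n] by (simp add: pos_le_divide_eq mult.commute)
  qed
  have lower: "S (x n) - e n \<le> T n ^ Suc r * (SUP l. \<bar>\<Delta> n {j. j \<le> l}\<bar>)" for n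
  proof -
    have "S (x n) - e n \<le> T n ^ Suc r * \<bar>\<Delta> n {j. j \<le> k n}\<bar>"
      using close[of n "k n"] by (simp add: x_def abs_le_iff)
    also have "\<dots> \<le> T n ^ Suc r * (SUP l. \<bar>\<Delta> n {j. j \<le> l}\<bar>)"
      using T(2)[of n] by (intro mult_left_mono cSUP_upper bdd) auto
    finally show ?thesis .
  qed
  have "x \<longlonglongrightarrow> z"
  proof (rule tendsto_sandwich[of "\<lambda>_. z" x _ "\<lambda>n. z + inverse (T n)"])
    show "(\<lambda>n. z + inverse (T n)) \<longlonglongrightarrow> z"
      using tendsto_add[OF tendsto_const[of z] tendsto_inverse_0_at_top[OF T(1)]] by simp
    have "z \<le> x n \<and> x n \<le> z + inverse (T n)" for n
    proof -
      have "T n * z \<le> m * lam n - of_int (k n)" "m * lam n - of_int (k n) \<le> T n * z + 1"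
        using floor_correct[of "m * lam n - T n * z"] unfolding k_def by linarith+
      then have "z \<le> x n" "x n \<le> (T n * z + 1) / T n"
        using T(2)[of n] unfolding x_def by (simp_all add: pos_le_divide_eq divide_right_mono mult.commute)
      then show ?thesis using T(2)[of n] by (simp add: add_divide_distrib inverse_eq_divide)
    qed
    then show "\<forall>\<^sub>F n in sequentially. z \<le> x n" "\<forall>\<^sub>F n in sequentially. x n \<le> z + inverse (T n)" by simp_all
  qed simp
  moreover have "isCont S z"
    unfolding S_def
    by (intro continuous_intros DERIV_isCont[OF has_real_derivative_hermite_fun]) simp
  ultimately have "(\<lambda>n. S (x n)) \<longlonglongrightarrow> S z" by (simp add: isCont_tendsto_compose)
  then have "(\<lambda>n. S (x n) - e n) \<longlonglongrightarrow> S z" using e tendsto_diff by fastforce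
  moreover have "(\<lambda>n. S z + e n) \<longlonglongrightarrow> S z" using tendsto_add[OF tendsto_const e] by simp
  ultimately have "(\<lambda>n. T n ^ Suc r * (SUP k. \<bar>\<Delta> n {j. j \<le> k}\<bar>)) \<longlonglongrightarrow> S z"
    by (rule tendsto_sandwich[rotated 2]) (rule always_eventually, rule allI, rule lower upper)+
  then show ?thesis by (simp add: S_def z_def)
qed

subsection \<open>Residues and the Kolmogorov distance\<close>

lemma abs_conv_fourier_series_bounded:
  assumes "abs_conv_fourier_series f"
  obtains B where "\<And>\<xi>. norm (f \<xi>) \<le> B"
proof -
  obtain c where c: "(\<lambda>k. norm (c k)) summable_on UNIV"
    "\<And>\<xi>. f \<xi> = (\<Sum>\<^sub>\<infinity>k\<in>UNIV. c k * exp (\<i> * of_int k * of_real \<xi>))"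
    using assms unfolding abs_conv_fourier_series_def by blast
  have "norm (f \<xi>) \<le> (\<Sum>\<^sub>\<infinity>k\<in>UNIV. norm (c k))" for \<xi>
  proof -
    have "norm (c k * exp (\<i> * of_int k * of_real \<xi>)) = norm (c k)" for k by (simp add: norm_mult)
    then show ?thesis
      unfolding c(2) using norm_infsum_bound[of "\<lambda>k. c k * exp (\<i> * of_int k * of_real \<xi>)" UNIV] c(1) by simp
  qed
  then show thesis by (rule that)
qed

text \<open>Close to the origin the expansion gives the power of \<open>\<bar>\<xi>\<bar>\<close>,
  with \<open>1 + \<epsilon> n \<xi>\<close> of norm at most \<open>2\<close>; at distance
  \<open>d\<close> and beyond, a uniform bound on the residues is divided by
  \<open>d ^ Suc r\<close>.\<close>

lemma residue_difference_bound:
  fixes \<psi> chi :: "nat \<Rightarrow> real \<Rightarrow> complex"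
  assumes series: "abs_conv_fourier_series \<psi>lim" "abs_conv_fourier_series chilim"
    and unif: "uniform_limit UNIV \<psi> \<psi>lim sequentially" "uniform_limit UNIV chi chilim sequentially"
    and \<beta>: "\<beta> \<longlonglongrightarrow> \<beta>lim"
    and near: "\<forall>\<^sub>F \<xi> in at 0. \<forall>n. \<psi> n \<xi> - chi n \<xi> = \<beta> n * (\<i> * of_real \<xi>) ^ (r + 1) * (1 + \<epsilon> n \<xi>)"
    and \<epsilon>: "uniform_limit UNIV (\<lambda>\<xi> n. \<epsilon> n \<xi>) (\<lambda>n. 0) (at 0)"
    and zero: "\<And>n. \<psi> n 0 = chi n 0"
  obtains C where "\<forall>\<^sub>F n in sequentially. \<forall>\<xi>. norm (\<psi> n \<xi> - chi n \<xi>) \<le> C * \<bar>\<xi>\<bar> ^ Suc r"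
proof -
  obtain P where P: "\<And>\<xi>. norm (\<psi>lim \<xi>) \<le> P" using abs_conv_fourier_series_bounded[OF series(1)] by blast
  obtain Q where Q: "\<And>\<xi>. norm (chilim \<xi>) \<le> Q" using abs_conv_fourier_series_bounded[OF series(2)] by blast
  obtain B where B: "\<And>n. norm (\<beta> n) \<le> B"
    using convergent_imp_Bseq[OF convergentI[OF \<beta>]] by (auto simp: Bseq_def)
  have "\<forall>\<^sub>F \<xi> in at 0. \<forall>n. norm (\<epsilon> n \<xi>) < 1"
    using uniform_limitD[OF \<epsilon>, of 1] by simp
  with near have "\<forall>\<^sub>F \<xi> in at 0. \<forall>n. norm (\<psi> n \<xi> - chi n \<xi>) \<le> 2 * B * \<bar>\<xi>\<bar> ^ Suc r"
  proof eventually_elim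
    case (elim \<xi>)
    show ?case
    proof
      fix n
      have "norm (1 + \<epsilon> n \<xi>) \<le> 2"
        using norm_triangle_ineq[of 1 "\<epsilon> n \<xi>"] elim(2)[rule_format, of n] by simp
      then have "norm (\<beta> n) * \<bar>\<xi>\<bar> ^ Suc r * norm (1 + \<epsilon> n \<xi>) \<le> B * \<bar>\<xi>\<bar> ^ Suc r * 2"
        using B[of n] order_trans[OF norm_ge_zero B] by (intro mult_mono) auto
      then show "norm (\<psi> n \<xi> - chi n \<xi>) \<le> 2 * B * \<bar>\<xi>\<bar> ^ Suc r"
        using elim(1) by (simp add: norm_mult norm_power mult_ac)
    qed
  qed
  then obtain d where d: "d > 0"
    "\<And>\<xi> n. \<xi> \<noteq> 0 \<Longrightarrow> \<bar>\<xi>\<bar> < d \<Longrightarrow> norm (\<psi> n \<xi> - chi n \<xi>) \<le> 2 * B * \<bar>\<xi>\<bar> ^ Suc r"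
    unfolding eventually_at by (auto simp: dist_real_def)
  \<comment> \<open>Eventually in \<open>n\<close> the residues are within \<open>1\<close> of their
    limits, hence bounded by \<open>P + 1\<close> and \<open>Q + 1\<close>.\<close>
  define D where "D = max 0 (P + Q + 2)"
  define C where "C = max (2 * B) (D / d ^ Suc r)"
  have "\<forall>\<^sub>F n in sequentially. \<forall>\<xi>. norm (\<psi> n \<xi> - chi n \<xi>) \<le> C * \<bar>\<xi>\<bar> ^ Suc r"
    using uniform_limitD[OF unif(1), of 1, OF zero_less_one] uniform_limitD[OF unif(2), of 1, OF zero_less_one]
  proof eventually_elim
    case (elim n)
    show ?case
    proof
      fix \<xi> :: real
      \<comment> \<open>The expansion only concerns a punctured neighbourhood; the origin itself is
        covered by the hypothesis \<open>zero\<close>.\<close>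
      consider "\<xi> = 0" | "\<xi> \<noteq> 0" "\<bar>\<xi>\<bar> < d" | "d \<le> \<bar>\<xi>\<bar>" by linarith
      then show "norm (\<psi> n \<xi> - chi n \<xi>) \<le> C * \<bar>\<xi>\<bar> ^ Suc r"
      proof cases
        case 1
        then show ?thesis by (simp add: zero)
      next
        case 2
        have "2 * B * \<bar>\<xi>\<bar> ^ Suc r \<le> C * \<bar>\<xi>\<bar> ^ Suc r" by (intro mult_right_mono) (auto simp: C_def)
        with d(2)[OF 2] show ?thesis by (rule order_trans)
      next
        case 3
        have "norm (\<psi> n \<xi>) \<le> P + 1"
          using elim(1) P[of \<xi>] norm_triangle_ineq2[of "\<psi> n \<xi>" "\<psi>lim \<xi>"] by (auto simp: dist_norm) (smt (verit))
        moreover have "norm (chi n \<xi>) \<le> Q + 1"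
          using elim(2) Q[of \<xi>] norm_triangle_ineq2[of "chi n \<xi>" "chilim \<xi>"] by (auto simp: dist_norm) (smt (verit))
        ultimately have "norm (\<psi> n \<xi> - chi n \<xi>) \<le> D"
          using norm_triangle_ineq4[of "\<psi> n \<xi>" "chi n \<xi>"] by (simp add: D_def)
        also have "D = D / d ^ Suc r * d ^ Suc r" using d by simp
        also have "\<dots> \<le> C * \<bar>\<xi>\<bar> ^ Suc r"
          using 3 d by (intro mult_mono power_mono) (auto simp: C_def D_def le_max_iff_disj)
        finally show ?thesis .
      qed
    qed
  qed
  then show thesis by (rule that)
qed

theorem theorem3p6:
  fixes p :: "int pmf" and \<phi> :: "real \<Rightarrow> complex" and m \<sigma> :: real
    and M :: "nat \<Rightarrow> 'a measure" and X :: "nat \<Rightarrow> 'a \<Rightarrow> int"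
    and \<nu> :: "nat \<Rightarrow> int set \<Rightarrow> real" and lam :: "nat \<Rightarrow> real"
    and \<psi> chi :: "nat \<Rightarrow> real \<Rightarrow> complex" and \<psi>lim chilim :: "real \<Rightarrow> complex"
    and r :: nat and \<beta> :: "nat \<Rightarrow> complex" and \<beta>lim :: complex
    and \<epsilon> :: "nat \<Rightarrow> real \<Rightarrow> complex" and \<epsilon>lim :: "real \<Rightarrow> complex"
  assumes "reference_exponent p \<phi>"
    and "(\<lambda>\<xi>. \<phi> \<xi> - (\<i> * of_real (m * \<xi>) - of_real (\<sigma>\<^sup>2 * \<xi>\<^sup>2 / 2)))
           \<in> o[at 0](\<lambda>\<xi>. of_real (\<xi>\<^sup>2))"
    and "\<And>n. prob_space (M n)"
    and "\<And>n. X n \<in> M n \<rightarrow>\<^sub>M count_space UNIV"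
    and "mod_phi_convergent \<phi> M X lam \<psi> \<psi>lim"
    and "approximation_scheme \<phi> \<nu> lam chi chilim"
    and "\<beta> \<longlonglongrightarrow> \<beta>lim"
    and "\<forall>\<^sub>F \<xi> in at 0. \<forall>n. \<psi> n \<xi> - chi n \<xi> = \<beta> n * (\<i> * of_real \<xi>) ^ (r + 1) * (1 + \<epsilon> n \<xi>)"
    and "uniform_limit UNIV (\<lambda>\<xi> n. \<epsilon> n \<xi>) (\<lambda>n. 0) (at 0)"
    and "\<forall>\<^sub>F \<xi> in at 0. \<psi>lim \<xi> - chilim \<xi> = \<beta>lim * (\<i> * of_real \<xi>) ^ (r + 1) * (1 + \<epsilon>lim \<xi>)"
    and "(\<epsilon>lim \<longlongrightarrow> 0) (at 0)"
  shows "(\<lambda>n. kolmogorov_dist (law_Z (M n) (X n)) (\<nu> n)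
            - norm \<beta>lim * \<bar>hermite_fun r (hermite_z (r + 1))\<bar>
                / (sqrt (2 * pi) * (\<sigma>\<^sup>2 * lam n) powr ((real r + 1) / 2)))
         \<in> o(\<lambda>n. 1 / lam n powr ((real r + 1) / 2))"
proof -
  note ref = assms(1) and expansion = assms(2)
  have \<sigma>: "\<sigma> \<noteq> 0" by (rule reference_exponent_sigma_nonzero[OF ref expansion])
  obtain c where c: "c > 0" "\<And>\<xi>. \<bar>\<xi>\<bar> \<le> pi \<Longrightarrow> Re (\<phi> \<xi>) \<le> - c * \<xi>\<^sup>2"
    using reference_exponent_Re_bound[OF ref expansion] by blast
  have cont: "continuous_on UNIV \<phi>" and \<phi>0: "\<phi> 0 = 0" using ref by (simp_all add: reference_exponent_def)
  define \<mu> where "\<mu> n = law_Z (M n) (X n)" for n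
  have prob: "prob_space (distr (M n) (count_space UNIV) (X n))" for n
    by (rule prob_space.prob_space_distr[OF assms(3,4)])
  have \<mu>: "finite_signed_measure (\<mu> n)" "\<mu> n UNIV = 1" for n
  proof -
    show "finite_signed_measure (\<mu> n)"
      unfolding \<mu>_def law_Z_def
      by (rule finite_signed_measure_measure) (simp_all add: prob_space.finite_measure prob)
    show "\<mu> n UNIV = 1"
      unfolding \<mu>_def law_Z_def using prob_space.prob_space[OF prob, of n] by simp
  qed
  have \<psi>: "filterlim lam at_top sequentially" "abs_conv_fourier_series \<psi>lim"
    "\<And>n \<xi>. fourier_Z (\<mu> n) \<xi> = exp (of_real (lam n) * \<phi> \<xi>) * \<psi> n \<xi>" "uniform_limit UNIV \<psi> \<psi>lim sequentially"
    using assms(5) by (simp_all add: mod_phi_convergent_def mod_phi_form_def \<mu>_def)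
  have chi: "\<And>n. finite_signed_measure (\<nu> n)" "abs_conv_fourier_series chilim"
    "\<And>n \<xi>. fourier_Z (\<nu> n) \<xi> = exp (of_real (lam n) * \<phi> \<xi>) * chi n \<xi>" "uniform_limit UNIV chi chilim sequentially"
    "\<And>n. chi n 0 = 1"
    using assms(6) by (simp_all add: approximation_scheme_def mod_phi_form_def)
  \<comment> \<open>Since \<open>\<phi> 0 = 0\<close>, the transform of a probability law at
    \<open>0\<close> forces \<open>\<psi> n 0 = 1\<close>, the value prescribed for
    \<open>chi n 0\<close>.\<close>
  have \<psi>_0: "\<psi> n 0 = chi n 0" for n
    using \<psi>(3)[of n 0] fourier_Z_0[OF \<mu>(1), of n] by (simp add: \<phi>0 \<mu>(2) chi(5))
  have \<nu>_UNIV: "\<nu> n UNIV = 1" for n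
  proof -
    have "complex_of_real (\<nu> n UNIV) = 1"
      using chi(3)[of n 0] fourier_Z_0[OF chi(1), of n] by (simp add: \<phi>0 chi(5))
    then show ?thesis by simp
  qed
  obtain C where C: "\<forall>\<^sub>F n in sequentially. \<forall>\<xi>. norm (\<psi> n \<xi> - chi n \<xi>) \<le> C * \<bar>\<xi>\<bar> ^ Suc r"
    using residue_difference_bound[OF \<psi>(2) chi(2) \<psi>(4) chi(4) assms(7-9) \<psi>_0] by blast
  have "\<forall>\<^sub>F n in sequentially. 0 < lam n"
    using filterlim_at_top_dense[THEN iffD1, OF \<psi>(1)] by blast
  \<comment> \<open>Positivity of \<open>lam n\<close> and the residue bound are known only
    eventually, while the approximation results ask for all indices; the sequence is therefore
    shifted by \<open>N\<close>.\<close>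
  with C obtain N where N: "\<And>n. n \<ge> N \<Longrightarrow> 0 < lam n"
    "\<And>n \<xi>. n \<ge> N \<Longrightarrow> norm (\<psi> n \<xi> - chi n \<xi>) \<le> C * \<bar>\<xi>\<bar> ^ Suc r"
    by (auto simp: eventually_conj_iff[symmetric] eventually_sequentially dest!: eventually_conj)
      (metis linorder_linear order_trans)
  define \<Delta> where "\<Delta> n A = \<mu> (n + N) A - \<nu> (n + N) A" for n A
  define w where "w n \<xi> = \<psi> (n + N) \<xi> - chi (n + N) \<xi>" for n \<xi>
  \<comment> \<open>The sign of \<open>\<sigma>\<close> is unconstrained, hence the absolute value
    in this scale.\<close>
  define T where "T n = \<bar>\<sigma>\<bar> * sqrt (lam (n + N))" for n
  have T: "filterlim T at_top sequentially" "\<And>n. T n > 0" "\<And>n. (T n)\<^sup>2 = \<sigma>\<^sup>2 * lam (n + N)"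
  proof -
    have "filterlim (\<lambda>n. lam (n + N)) at_top sequentially"
      by (rule filterlim_compose[OF \<psi>(1) filterlim_add_const_nat_at_top])
    then show "filterlim T at_top sequentially"
      unfolding T_def using \<sigma>
      by (intro filterlim_tendsto_pos_mult_at_top[OF tendsto_const] filterlim_compose[OF sqrt_at_top]) auto
    show "T n > 0" "(T n)\<^sup>2 = \<sigma>\<^sup>2 * lam (n + N)" for n
      using \<sigma> N(1)[of "n + N"] by (simp_all add: T_def power_mult_distrib)
  qed
  have lim: "(\<lambda>n. of_real (T n ^ Suc r) * w n (u / T n)) \<longlonglongrightarrow> \<beta>lim * (\<i> * of_real u) ^ Suc r" if "u \<noteq> 0" for u
  proof -
    have at0: "filterlim (\<lambda>n. u / T n) (at 0) sequentially"
      by (rule filterlim_divide_at_0[OF T(1,2) that])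
    have "(\<lambda>n. \<epsilon> (n + N) (u / T n)) \<longlonglongrightarrow> 0"
    proof (rule tendstoI)
      fix e :: real assume "e > 0"
      from uniform_limitD[OF assms(9) this] have "\<forall>\<^sub>F \<xi> in at 0. \<forall>n. dist (\<epsilon> n \<xi>) 0 < e" by simp
      from eventually_compose_filterlim[OF this at0]
      show "\<forall>\<^sub>F n in sequentially. dist (\<epsilon> (n + N) (u / T n)) 0 < e" by eventually_elim simp
    qed
    then have "(\<lambda>n. \<beta> (n + N) * (\<i> * of_real u) ^ Suc r * (1 + \<epsilon> (n + N) (u / T n))) \<longlonglongrightarrow>
      \<beta>lim * (\<i> * of_real u) ^ Suc r * (1 + 0)"
      by (intro tendsto_mult tendsto_add tendsto_const LIMSEQ_ignore_initial_segment assms(7))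
    moreover have "\<forall>\<^sub>F n in sequentially. \<beta> (n + N) * (\<i> * of_real u) ^ Suc r * (1 + \<epsilon> (n + N) (u / T n)) =
        of_real (T n ^ Suc r) * w n (u / T n)"
      using eventually_compose_filterlim[OF assms(8) at0]
    proof eventually_elim
      case (elim n)
      have "w n (u / T n) = \<beta> (n + N) * (\<i> * of_real (u / T n)) ^ (r + 1) * (1 + \<epsilon> (n + N) (u / T n))"
        unfolding w_def using elim by blast
      moreover have "of_real (T n ^ Suc r) * (\<i> * of_real (u / T n)) ^ (r + 1) = (\<i> * of_real u) ^ Suc r"
        using T(2)[of n] by (simp add: power_mult_distrib power_divide)
      ultimately show ?case by (metis mult.assoc mult.left_commute)
    qed
    ultimately show ?thesis by (simp add: Lim_transform_eventually)
  qed
  obtain e where e: "e \<longlonglongrightarrow> 0" "\<And>n k. norm (of_real (T n ^ Suc r * \<Delta> n {j. j \<le> k})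
        + \<beta>lim * of_real (hermite_fun r ((m * lam (n + N) - of_int k) / T n) / sqrt (2 * pi))) \<le> e n"
  proof (rule cumulative_approximation[OF cont c expansion T \<sigma>, where \<Delta> = \<Delta> and w = w and C = C and b = \<beta>lim and r = r])
    show "finite_signed_measure (\<Delta> n)" for n
      unfolding \<Delta>_def[abs_def] by (intro finite_signed_measure_diff \<mu> chi)
    show "\<Delta> n UNIV = 0" for n by (simp add: \<Delta>_def \<mu> \<nu>_UNIV)
    show "fourier_Z (\<Delta> n) \<xi> = exp (of_real (lam (n + N)) * \<phi> \<xi>) * w n \<xi>" for n \<xi>
      unfolding \<Delta>_def[abs_def] by (simp add: fourier_Z_diff \<mu> chi(1) \<psi>(3) chi(3) w_def right_diff_distrib)
    show "norm (w n \<xi>) \<le> C * \<bar>\<xi>\<bar> ^ Suc r" for n \<xi>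
      unfolding w_def by (rule N) simp
  qed (use lim in auto)
  define K where "K n = kolmogorov_dist (\<mu> n) (\<nu> n)" for n
  define L where "L = norm \<beta>lim * \<bar>hermite_fun r (hermite_z (Suc r))\<bar> / sqrt (2 * pi)"
  have "(\<lambda>n. T n ^ Suc r * (SUP k. \<bar>\<Delta> n {j. j \<le> k}\<bar>)) \<longlonglongrightarrow> L"
    unfolding L_def by (rule sup_cumulative_limit[OF T(1,2) e])
  then have "(\<lambda>n. T n ^ Suc r * K (n + N)) \<longlonglongrightarrow> L"
    by (simp add: K_def kolmogorov_dist_def \<Delta>_def)
  \<comment> \<open>The claimed error is measured against \<open>lam n\<close> rather than
    \<open>T n\<close>, so the powers of \<open>\<bar>\<sigma>\<bar>\<close> are divided
    out.\<close>
  from tendsto_divide[OF tendsto_diff[OF this tendsto_const[of L]] tendsto_const[of "\<bar>\<sigma>\<bar> ^ Suc r"]] \<sigma>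
  have "(\<lambda>n. (T n ^ Suc r * K (n + N) - L) / \<bar>\<sigma>\<bar> ^ Suc r) \<longlonglongrightarrow> 0" by simp
  moreover have "(T n ^ Suc r * K (n + N) - L) / \<bar>\<sigma>\<bar> ^ Suc r =
      (K (n + N) - norm \<beta>lim * \<bar>hermite_fun r (hermite_z (r + 1))\<bar>
        / (sqrt (2 * pi) * (\<sigma>\<^sup>2 * lam (n + N)) powr ((real r + 1) / 2)))
      / (1 / lam (n + N) powr ((real r + 1) / 2))" for n
  proof -
    have pw: "sqrt x ^ Suc r = x powr ((real r + 1) / 2)" if "x > 0" for x :: real
    proof -
      have "sqrt x ^ Suc r = (x powr (1 / 2)) powr real (Suc r)"
        using that by (simp add: powr_half_sqrt powr_realpow del: of_nat_Suc power_Suc)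
      also have "\<dots> = x powr ((real r + 1) / 2)" by (simp add: powr_powr add.commute)
      finally show ?thesis .
    qed
    have lam: "lam (n + N) > 0" by (rule N) simp
    have "T n = sqrt (\<sigma>\<^sup>2 * lam (n + N))" by (simp add: T_def real_sqrt_mult)
    then have 1: "(\<sigma>\<^sup>2 * lam (n + N)) powr ((real r + 1) / 2) = T n ^ Suc r"
      using pw[of "\<sigma>\<^sup>2 * lam (n + N)"] lam \<sigma> by simp
    have 2: "lam (n + N) powr ((real r + 1) / 2) = T n ^ Suc r / \<bar>\<sigma>\<bar> ^ Suc r"
      unfolding pw[OF lam, symmetric] T_def power_mult_distrib using \<sigma> by simp
    show ?thesis
      unfolding 1 2 using T(2)[of n] \<sigma> by (simp add: L_def field_simps del: power_Suc)
  qed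
  ultimately have "(\<lambda>n. (K (n + N) - norm \<beta>lim * \<bar>hermite_fun r (hermite_z (r + 1))\<bar>
        / (sqrt (2 * pi) * (\<sigma>\<^sup>2 * lam (n + N)) powr ((real r + 1) / 2)))
      / (1 / lam (n + N) powr ((real r + 1) / 2))) \<longlonglongrightarrow> 0"
    by (simp only:)
  \<comment> \<open>Finitely many initial indices do not affect the limit, so the shift is
    undone.\<close>
  then have "(\<lambda>n. (K n - norm \<beta>lim * \<bar>hermite_fun r (hermite_z (r + 1))\<bar>
        / (sqrt (2 * pi) * (\<sigma>\<^sup>2 * lam n) powr ((real r + 1) / 2)))
      / (1 / lam n powr ((real r + 1) / 2))) \<longlonglongrightarrow> 0"
    by (rule LIMSEQ_offset)
  moreover have "\<forall>\<^sub>F n in sequentially. 1 / lam n powr ((real r + 1) / 2) \<noteq> 0"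
    using eventually_ge_at_top[of N] by eventually_elim (use N(1) in force)
  ultimately show ?thesis
    unfolding K_def \<mu>_def by (intro smalloI_tendsto)
qed

end
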